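(* Let $\mathcal{H}_{\rm S}$ be a separable complex Hilbert space and let $\mathcal{E}$ be a random unitary channel on $\mathcal{H}_{\rm S}$, i.e. $\mathcal{E}[\varrho]=\sum_j p_j U_j\varrho U_j^\dagger$ for a (finite or countable) family of unitary operators $U_j$ on $\mathcal{H}_{\rm S}$ and numbers $0\le p_j\le 1$ with $\sum_j p_j=1$. Then $\mathcal{E}$ is repeatable.
   Context: A state on a Hilbert space is a density operator (positive trace-class operator of unit trace). A quantum channel on $\mathcal{H}_{\rm S}$ is a completely positive trace-preserving linear map $\mathcal{E}$ on the trace-class operators on $\mathcal{H}_{\rm S}$. Let $\mathcal{H}_{\rm M}$ be a separable complex Hilbert space (the memory), $U$ a unitary operator on $\mathcal{H}_{\rm M}\otimes\mathcal{H}_{\rm S}$, and $\xi$ a state on $\mathcal{H}_{\rm M}$ (the initial memory state). Given a sequence of input states $\varrho_1,\varrho_2,\dots$ on $\mathcal{H}_{\rm S}$ (the inputs are uncorrelated with each other and the same $U$ is applied at each use of the device, with no reset of the memory), define the memory states recursively by $\xi_1=\xi$ and $\xi_{j+1}=\mathrm{Tr}_{\rm S}[U(\xi_j\otimes\varrho_j)U^\dagger]$. The channel induced at the $j$-th use is $\mathcal{E}_j[\varrho]=\mathrm{Tr}_{\rm M}[U(\xi_j\otimes\varrho)U^\dagger]$. Here $\mathrm{Tr}_{\rm M}$ and $\mathrm{Tr}_{\rm S}$ denote the partial traces over $\mathcal{H}_{\rm M}$ and $\mathcal{H}_{\rm S}$. In general $\mathcal{E}_j$ depends on $\varrho_1,\dots,\varrho_{j-1}$.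 A quantum channel $\mathcal{E}$ is called repeatable if there exist a memory space $\mathcal{H}_{\rm M}$, a unitary $U$ on $\mathcal{H}_{\rm M}\otimes\mathcal{H}_{\rm S}$ and a state $\xi$ on $\mathcal{H}_{\rm M}$ such that, for every choice of input states $\varrho_1,\varrho_2,\dots$, one has $\mathcal{E}_1=\dots=\mathcal{E}_n=\mathcal{E}$ for all $n>0$. *)

theory Defs
  imports "HOL-Analysis.Analysis"
begin

section \<open>Complex Hilbert spaces\<close>

text \<open>The inner product is antilinear in its first argument.\<close>

class complex_inner = real_normed_vector +
  fixes scaleC :: "complex \<Rightarrow> 'a \<Rightarrow> 'a"  (infixr \<open>*\<^sub>C\<close> 75)
    and cinner :: "'a \<Rightarrow> 'a \<Rightarrow> complex"
  assumes scaleC_add_right: "c *\<^sub>C (x + y) = c *\<^sub>C x + c *\<^sub>C y"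
    and scaleC_add_left: "(c + d) *\<^sub>C x = c *\<^sub>C x + d *\<^sub>C x"
    and scaleC_scaleC: "c *\<^sub>C d *\<^sub>C x = (c * d) *\<^sub>C x"
    and scaleC_of_real: "complex_of_real r *\<^sub>C x = r *\<^sub>R x"
    and cinner_commute: "cinner x y = cnj (cinner y x)"
    and cinner_add_right: "cinner x (y + z) = cinner x y + cinner x z"
    and cinner_scaleC_right: "cinner x (c *\<^sub>C y) = c * cinner x y"
    and cinner_self: "cinner x x = complex_of_real ((norm x)\<^sup>2)"

class chilbert_space = complex_inner + complete_space

lemma cinner_add_left: "cinner (x + y) z = cinner x z + cinner y z"
  for x :: "'a :: complex_inner"
  by (metis cinner_add_right cinner_commute complex_cnj_add)

lemma cinner_scaleC_left: "cinner (c *\<^sub>C x) y = cnj c * cinner x y"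
  for x :: "'a :: complex_inner"
  by (metis cinner_scaleC_right cinner_commute complex_cnj_mult)

lemma scaleC_one [simp]: "1 *\<^sub>C x = x" for x :: "'a :: complex_inner"
  using scaleC_of_real[of 1 x] by simp

lemma norm_scaleC: "norm (c *\<^sub>C x) = norm c * norm x" for x :: "'a :: complex_inner"
proof -
  have "complex_of_real ((norm (c *\<^sub>C x))\<^sup>2) = cnj c * c * complex_of_real ((norm x)\<^sup>2)"
    by (metis cinner_self cinner_scaleC_left cinner_scaleC_right mult.assoc mult.left_commute)
  also have "\<dots> = complex_of_real ((norm c * norm x)\<^sup>2)"
    by (metis complex_norm_square mult.commute of_real_mult power_mult_distrib)
  finally have "(norm (c *\<^sub>C x))\<^sup>2 = (norm c * norm x)\<^sup>2"
    using of_real_eq_iff by blast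
  then show ?thesis by simp
qed

lemma norm_cinner_le: "norm (cinner x y) \<le> ((norm x)\<^sup>2 + (norm y)\<^sup>2) / 2"
  for x :: "'a :: complex_inner"
proof (cases "cinner x y = 0")
  case False
  define c where "c = - cnj (cinner x y) / norm (cinner x y)"
  have nc: "norm c = 1" using False by (simp add: c_def norm_divide)
  have cc: "c * cinner x y = - complex_of_real (norm (cinner x y))"
  proof -
    have "cnj (cinner x y) * cinner x y = complex_of_real (norm (cinner x y)) * norm (cinner x y)"
      using complex_norm_square[of "cinner x y"] by (simp add: power2_eq_square mult.commute)
    then show ?thesis using False by (simp add: c_def field_simps)
  qed
  have "complex_of_real ((norm (x + c *\<^sub>C y))\<^sup>2)
      = cinner x x + c * cinner x y + cnj (c * cinner x y) + cinner (c *\<^sub>C y) (c *\<^sub>C y)"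
    unfolding cinner_self[symmetric] cinner_add_left cinner_add_right
    using cinner_commute[of y x] by (simp add: cinner_scaleC_left cinner_scaleC_right)
  also have "\<dots> = complex_of_real ((norm x)\<^sup>2 - 2 * norm (cinner x y) + (norm y)\<^sup>2)"
    unfolding cc cinner_self norm_scaleC nc by simp
  finally have "(norm (x + c *\<^sub>C y))\<^sup>2 = (norm x)\<^sup>2 - 2 * norm (cinner x y) + (norm y)\<^sup>2"
    using of_real_eq_iff by blast
  then have "0 \<le> (norm x)\<^sup>2 - 2 * norm (cinner x y) + (norm y)\<^sup>2"
    by (metis zero_le_power2)
  then show ?thesis by simp
qed simp

instantiation complex :: chilbert_space
begin
definition "c *\<^sub>C (x::complex) = c * x"
definition "cinner (x::complex) y = cnj x * y"
instance
proof
  fix x y z c d :: complex and r :: real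
  show "cinner x x = complex_of_real ((norm x)\<^sup>2)"
    unfolding cinner_complex_def complex_norm_square by (rule mult.commute)
qed (simp_all add: scaleC_complex_def cinner_complex_def scaleR_conv_of_real ring_distribs)
end

subsection \<open>The space of square-summable sequences\<close>

definition square_summable :: "(nat \<Rightarrow> 'a::real_normed_vector) \<Rightarrow> bool" where
  "square_summable f \<longleftrightarrow> summable (\<lambda>n. (norm (f n))\<^sup>2)"

lemma square_summableI:
  assumes "\<And>n. L2_set (\<lambda>i. norm (f i)) {..<n} \<le> C"
  shows "square_summable f" "sqrt (\<Sum>i. (norm (f i))\<^sup>2) \<le> C"
proof -
  have C: "0 \<le> C" using assms[of 0] by simp
  have b: "(\<Sum>i<n. (norm (f i))\<^sup>2) \<le> C\<^sup>2" for n
    using assms[of n] C unfolding L2_set_def by (simp add: sqrt_le_D)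
  then show s: "square_summable f"
    unfolding square_summable_def by (intro summableI_nonneg_bounded) auto
  have "(\<Sum>i. (norm (f i))\<^sup>2) \<le> C\<^sup>2"
    using s b unfolding square_summable_def by (intro suminf_le_const) auto
  then show "sqrt (\<Sum>i. (norm (f i))\<^sup>2) \<le> C"
    using C by (simp add: real_le_lsqrt suminf_nonneg)
qed

lemma L2_set_le_suminf:
  assumes "square_summable f"
  shows "L2_set (\<lambda>i. norm (f i)) {..<n} \<le> sqrt (\<Sum>i. (norm (f i))\<^sup>2)"
  using assms unfolding L2_set_def square_summable_def
  by (intro real_sqrt_le_mono sum_le_suminf) auto

lemma square_summable_add:
  assumes "square_summable f" "square_summable g"
  shows "square_summable (\<lambda>n. f n + g n)"
    and "sqrt (\<Sum>i. (norm (f i + g i))\<^sup>2)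
      \<le> sqrt (\<Sum>i. (norm (f i))\<^sup>2) + sqrt (\<Sum>i. (norm (g i))\<^sup>2)"
proof -
  have "L2_set (\<lambda>i. norm (f i + g i)) {..<n}
      \<le> sqrt (\<Sum>i. (norm (f i))\<^sup>2) + sqrt (\<Sum>i. (norm (g i))\<^sup>2)" for n
  proof -
    have "L2_set (\<lambda>i. norm (f i + g i)) {..<n} \<le> L2_set (\<lambda>i. norm (f i) + norm (g i)) {..<n}"
      by (intro L2_set_mono) (auto simp: norm_triangle_ineq)
    also have "\<dots> \<le> L2_set (\<lambda>i. norm (f i)) {..<n} + L2_set (\<lambda>i. norm (g i)) {..<n}"
      by (rule L2_set_triangle_ineq)
    finally show ?thesis using L2_set_le_suminf[OF assms(1), of n] L2_set_le_suminf[OF assms(2), of n]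
      by linarith
  qed
  from square_summableI[OF this]
  show "square_summable (\<lambda>n. f n + g n)"
    and "sqrt (\<Sum>i. (norm (f i + g i))\<^sup>2)
      \<le> sqrt (\<Sum>i. (norm (f i))\<^sup>2) + sqrt (\<Sum>i. (norm (g i))\<^sup>2)" by auto
qed

typedef (overloaded) 'a ell2 = "{f :: nat \<Rightarrow> 'a::complex_inner. square_summable f}"
  morphisms ell2_nth Abs_ell2
  by (rule exI[of _ "\<lambda>_. 0"]) (simp add: square_summable_def)

setup_lifting type_definition_ell2

instantiation ell2 :: (complex_inner) real_vector
begin

lift_definition zero_ell2 :: "'a ell2" is "\<lambda>_. 0"
  by (simp add: square_summable_def)
lift_definition plus_ell2 :: "'a ell2 \<Rightarrow> 'a ell2 \<Rightarrow> 'a ell2" is "\<lambda>f g n. f n + g n"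
  by (rule square_summable_add)
lift_definition uminus_ell2 :: "'a ell2 \<Rightarrow> 'a ell2" is "\<lambda>f n. - f n"
  by (simp add: square_summable_def)
lift_definition minus_ell2 :: "'a ell2 \<Rightarrow> 'a ell2 \<Rightarrow> 'a ell2" is "\<lambda>f g n. f n - g n"
proof -
  fix f g :: "nat \<Rightarrow> 'a" assume "square_summable f" "square_summable g"
  then show "square_summable (\<lambda>n. f n - g n)"
    using square_summable_add(1)[of f "\<lambda>n. - g n"] by (simp add: square_summable_def)
qed
lift_definition scaleR_ell2 :: "real \<Rightarrow> 'a ell2 \<Rightarrow> 'a ell2" is "\<lambda>c f n. c *\<^sub>R f n"
  by (auto simp: square_summable_def power_mult_distrib intro: summable_mult)

instance
  by standard (transfer; simp add: algebra_simps)+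

end

instantiation ell2 :: (complex_inner) real_normed_vector
begin

lift_definition norm_ell2 :: "'a ell2 \<Rightarrow> real" is "\<lambda>f. sqrt (\<Sum>n. (norm (f n))\<^sup>2)" .
definition "dist x y = norm (x - y)" for x y :: "'a ell2"
definition "sgn x = inverse (norm x) *\<^sub>R x" for x :: "'a ell2"
definition [code del]:
  "(uniformity :: ('a ell2 \<times> 'a ell2) filter) = (INF e\<in>{0<..}. principal {(x, y). dist x y < e})"
definition [code del]:
  "open U \<longleftrightarrow> (\<forall>x\<in>U. \<forall>\<^sub>F (x', y) in uniformity. x' = x \<longrightarrow> y \<in> U)" for U :: "'a ell2 set"

instance
proof
  fix x y :: "'a ell2" and a :: real and U :: "'a ell2 set"
  show "dist x y = norm (x - y)" by (rule dist_ell2_def)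
  show "sgn x = x /\<^sub>R norm x" by (rule sgn_ell2_def)
  show "(uniformity :: ('a ell2 \<times> 'a ell2) filter) = (INF e\<in>{0<..}. principal {(x, y). dist x y < e})"
    by (rule uniformity_ell2_def)
  show "open U \<longleftrightarrow> (\<forall>x\<in>U. \<forall>\<^sub>F (x', y) in uniformity. x' = x \<longrightarrow> y \<in> U)" by (rule open_ell2_def)
  show "norm x = 0 \<longleftrightarrow> x = 0"
    by transfer (auto simp: square_summable_def suminf_eq_zero_iff fun_eq_iff)
  show "norm (x + y) \<le> norm x + norm y" by transfer (rule square_summable_add)
  show "norm (a *\<^sub>R x) = \<bar>a\<bar> * norm x"
    by transfer (simp add: square_summable_def power_mult_distrib suminf_mult real_sqrt_mult)
qed

end

lemma summable_cinner:
  fixes f g :: "nat \<Rightarrow> 'a::complex_inner"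
  assumes "square_summable f" "square_summable g"
  shows "summable (\<lambda>n. cinner (f n) (g n))"
proof (rule summable_comparison_test')
  show "summable (\<lambda>n. ((norm (f n))\<^sup>2 + (norm (g n))\<^sup>2) / 2)"
    using assms unfolding square_summable_def by (intro summable_divide summable_add)
qed (rule norm_cinner_le)

instantiation ell2 :: (complex_inner) complex_inner
begin

lift_definition scaleC_ell2 :: "complex \<Rightarrow> 'a ell2 \<Rightarrow> 'a ell2" is "\<lambda>c f n. c *\<^sub>C f n"
  by (auto simp: square_summable_def norm_scaleC power_mult_distrib intro: summable_mult)
lift_definition cinner_ell2 :: "'a ell2 \<Rightarrow> 'a ell2 \<Rightarrow> complex"
  is "\<lambda>f g. \<Sum>n. cinner (f n) (g n)" .

instance
proof
  fix x y z :: "'a ell2" and a :: real and c d :: complex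
  show "c *\<^sub>C (x + y) = c *\<^sub>C x + c *\<^sub>C y" by transfer (simp add: scaleC_add_right)
  show "(c + d) *\<^sub>C x = c *\<^sub>C x + d *\<^sub>C x" by transfer (simp add: scaleC_add_left)
  show "c *\<^sub>C d *\<^sub>C x = (c * d) *\<^sub>C x" by transfer (simp add: scaleC_scaleC)
  show "complex_of_real a *\<^sub>C x = a *\<^sub>R x" by transfer (simp add: scaleC_of_real)
  show "cinner x y = cnj (cinner y x)"
  proof transfer
    fix f g :: "nat \<Rightarrow> 'a" assume "square_summable f" "square_summable g"
    then have "(\<lambda>n. cnj (cinner (g n) (f n))) sums cnj (\<Sum>n. cinner (g n) (f n))"
      by (simp only: sums_cnj summable_cinner summable_sums)
    then show "(\<Sum>n. cinner (f n) (g n)) = cnj (\<Sum>n. cinner (g n) (f n))"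
      by (simp only: cinner_commute[symmetric] sums_iff)
  qed
  show "cinner x (y + z) = cinner x y + cinner x z"
    by transfer (simp add: cinner_add_right suminf_add summable_cinner)
  show "cinner x (c *\<^sub>C y) = c * cinner x y"
    by transfer (simp add: cinner_scaleC_right suminf_mult summable_cinner)
  show "cinner x x = complex_of_real ((norm x)\<^sup>2)"
  proof transfer
    fix f :: "nat \<Rightarrow> 'a" assume f: "square_summable f"
    then have "0 \<le> (\<Sum>n. (norm (f n))\<^sup>2)"
      unfolding square_summable_def by (simp add: suminf_nonneg)
    with f show "(\<Sum>n. cinner (f n) (f n)) = complex_of_real ((sqrt (\<Sum>n. (norm (f n))\<^sup>2))\<^sup>2)"
      unfolding cinner_self square_summable_def by (simp add: suminf_of_real[symmetric] del: of_real_power)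
  qed
qed

end

lemma norm_ell2_nth_le: "norm (ell2_nth x n) \<le> norm x" for x :: "'a::complex_inner ell2"
proof transfer
  fix f :: "nat \<Rightarrow> 'a" and n assume f: "square_summable f"
  have "norm (f n) \<le> L2_set (\<lambda>i. norm (f i)) {..<Suc n}"
    by (rule member_le_L2_set[where f = "\<lambda>i. norm (f i)"]) auto
  also have "\<dots> \<le> sqrt (\<Sum>i. (norm (f i))\<^sup>2)" by (rule L2_set_le_suminf[OF f])
  finally show "norm (f n) \<le> sqrt (\<Sum>i. (norm (f i))\<^sup>2)" .
qed

instance ell2 :: (chilbert_space) chilbert_space
proof
  fix X :: "nat \<Rightarrow> 'a ell2" assume X: "Cauchy X"
  have "Cauchy (\<lambda>n. ell2_nth (X n) i)" for i
  proof (rule metric_CauchyI)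
    fix e :: real assume "0 < e"
    then obtain N where N: "\<And>m n. N \<le> m \<Longrightarrow> N \<le> n \<Longrightarrow> dist (X m) (X n) < e"
      using metric_CauchyD[OF X] by blast
    have "dist (ell2_nth (X m) i) (ell2_nth (X n) i) \<le> dist (X m) (X n)" for m n
      using norm_ell2_nth_le[of "X m - X n" i] by (simp add: dist_norm minus_ell2.rep_eq)
    with N show "\<exists>N. \<forall>m\<ge>N. \<forall>n\<ge>N. dist (ell2_nth (X m) i) (ell2_nth (X n) i) < e"
      using le_less_trans by blast
  qed
  then have "\<exists>l. (\<lambda>n. ell2_nth (X n) i) \<longlonglongrightarrow> l" for i
    by (simp add: Cauchy_convergent convergent_def[symmetric])
  then obtain l where l: "\<And>i. (\<lambda>n. ell2_nth (X n) i) \<longlonglongrightarrow> l i" by metis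
  have key: "L2_set (\<lambda>i. norm (ell2_nth (X m) i - l i)) {..<k} \<le> e"
    if N: "\<And>m n. N \<le> m \<Longrightarrow> N \<le> n \<Longrightarrow> dist (X m) (X n) < e" and m: "N \<le> m" for e N m k
  proof (rule LIMSEQ_le_const2)
    show "(\<lambda>n. L2_set (\<lambda>i. norm (ell2_nth (X m) i - ell2_nth (X n) i)) {..<k})
        \<longlonglongrightarrow> L2_set (\<lambda>i. norm (ell2_nth (X m) i - l i)) {..<k}"
      unfolding L2_set_def by (intro tendsto_intros l)
    have "L2_set (\<lambda>i. norm (ell2_nth (X m) i - ell2_nth (X n) i)) {..<k} \<le> dist (X m) (X n)" for n
      using L2_set_le_suminf[of "ell2_nth (X m - X n)" k] ell2_nth[of "X m - X n"]
      by (simp add: dist_norm norm_ell2.rep_eq minus_ell2.rep_eq)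
    then show "\<exists>M. \<forall>n\<ge>M. L2_set (\<lambda>i. norm (ell2_nth (X m) i - ell2_nth (X n) i)) {..<k} \<le> e"
      using N[OF m] by (meson less_imp_le order_trans)
  qed
  obtain N1 where N1: "\<And>m n. N1 \<le> m \<Longrightarrow> N1 \<le> n \<Longrightarrow> dist (X m) (X n) < 1"
    using metric_CauchyD[OF X, of 1] by auto
  have "square_summable (\<lambda>i. ell2_nth (X N1) i - l i)"
    using key[OF N1 order_refl] by (rule square_summableI(1))
  then have "square_summable (\<lambda>i. - (ell2_nth (X N1) i - l i))" by (simp only: square_summable_def norm_minus_cancel)
  from square_summable_add(1)[OF this, of "ell2_nth (X N1)"] ell2_nth[of "X N1"]
  have ls: "square_summable l" by simp
  define L where "L = Abs_ell2 l"
  have L: "ell2_nth L = l" using ls by (simp add: L_def Abs_ell2_inverse)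
  have "X \<longlonglongrightarrow> L"
  proof (rule metric_LIMSEQ_I)
    fix e :: real assume "0 < e"
    then obtain N where N: "\<And>m n. N \<le> m \<Longrightarrow> N \<le> n \<Longrightarrow> dist (X m) (X n) < e / 2"
      using metric_CauchyD[OF X, of "e / 2"] by auto
    have "dist (X m) L \<le> e / 2" if "N \<le> m" for m
      using square_summableI(2)[OF key[OF N that]]
      by (simp add: dist_norm norm_ell2.rep_eq minus_ell2.rep_eq L)
    then show "\<exists>N. \<forall>m\<ge>N. dist (X m) L < e" using \<open>0 < e\<close> by (intro exI[of _ N]) force
  qed
  then show "convergent X" by (rule convergentI)
qed

section \<open>Operators\<close>

text \<open>
  Hilbert spaces are represented as closed subspaces \<open>H\<close> of a type of class
  \<^class>\<open>chilbert_space\<close>; an operator on \<open>H\<close> is extensional outside of \<open>H\<close>, so that equality of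
  operators is equality on \<open>H\<close>.
\<close>

definition separable_hilbert_space :: "'h::chilbert_space set \<Rightarrow> bool" where
  "separable_hilbert_space H \<longleftrightarrow>
    module.subspace (*\<^sub>C) H \<and> closed H \<and> separable_space (top_of_set H)"

definition bounded_op :: "'h::chilbert_space set \<Rightarrow> ('h \<Rightarrow> 'h) \<Rightarrow> bool" where
  "bounded_op H A \<longleftrightarrow> A \<in> H \<rightarrow>\<^sub>E H \<and>
    (\<forall>x\<in>H. \<forall>y\<in>H. A (x + y) = A x + A y) \<and>
    (\<forall>c. \<forall>x\<in>H. A (c *\<^sub>C x) = c *\<^sub>C A x) \<and>
    (\<exists>C. \<forall>x\<in>H. norm (A x) \<le> C * norm x)"

definition adjoint_op :: "'h::chilbert_space set \<Rightarrow> ('h \<Rightarrow> 'h) \<Rightarrow> 'h \<Rightarrow> 'h" where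
  "adjoint_op H A =
    (THE B. bounded_op H B \<and> (\<forall>x\<in>H. \<forall>y\<in>H. cinner (A x) y = cinner x (B y)))"

definition unitary_op :: "'h::chilbert_space set \<Rightarrow> ('h \<Rightarrow> 'h) \<Rightarrow> bool" where
  "unitary_op H U \<longleftrightarrow> bounded_op H U \<and> U ` H = H \<and>
    (\<forall>x\<in>H. \<forall>y\<in>H. cinner (U x) (U y) = cinner x y)"

definition conjugate_by :: "'h::chilbert_space set \<Rightarrow> ('h \<Rightarrow> 'h) \<Rightarrow> ('h \<Rightarrow> 'h) \<Rightarrow> 'h \<Rightarrow> 'h" where
  "conjugate_by H U A = compose H U (compose H A (adjoint_op H U))"

definition positive_op :: "'h::chilbert_space set \<Rightarrow> ('h \<Rightarrow> 'h) \<Rightarrow> bool" where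
  "positive_op H A \<longleftrightarrow> bounded_op H A \<and> (\<forall>x\<in>H. cinner x (A x) \<in> \<real>\<^sub>\<ge>\<^sub>0)"

definition is_onb :: "'h::chilbert_space set \<Rightarrow> 'h set \<Rightarrow> bool" where
  "is_onb H B \<longleftrightarrow> B \<subseteq> H \<and> (\<forall>x\<in>B. \<forall>y\<in>B. cinner x y = (if x = y then 1 else 0)) \<and>
    closure (module.span (*\<^sub>C) B) = H"

text \<open>The trace of a trace-class operator does not depend on the choice of the basis.\<close>

definition some_onb :: "'h::chilbert_space set \<Rightarrow> 'h set" where
  "some_onb H = (SOME B. is_onb H B)"

definition op_trace :: "'h::chilbert_space set \<Rightarrow> ('h \<Rightarrow> 'h) \<Rightarrow> complex" where
  "op_trace H A = (\<Sum>\<^sub>\<infinity>e\<in>some_onb H. cinner e (A e))"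

text \<open>
  As in Pedersen's \<^emph>\<open>Analysis Now\<close>, the trace-class operators are the linear span of the positive
  operators of finite trace. These form a convex cone, so every element of the span is of the form
  \<open>P0 + \<i> P1 - P2 - \<i> P3\<close> with four of them.
\<close>

definition positive_finite_trace :: "'h::chilbert_space set \<Rightarrow> ('h \<Rightarrow> 'h) \<Rightarrow> bool" where
  "positive_finite_trace H P \<longleftrightarrow>
    positive_op H P \<and> (\<lambda>e. cinner e (P e)) summable_on some_onb H"

definition trace_class :: "'h::chilbert_space set \<Rightarrow> ('h \<Rightarrow> 'h) \<Rightarrow> bool" where
  "trace_class H A \<longleftrightarrow> bounded_op H A \<and>
    (\<exists>P. (\<forall>k<4. positive_finite_trace H (P k)) \<and> (\<forall>x\<in>H. A x = (\<Sum>k<4. \<i> ^ k *\<^sub>C P k x)))"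

definition density_op :: "'h::chilbert_space set \<Rightarrow> ('h \<Rightarrow> 'h) \<Rightarrow> bool" where
  "density_op H \<rho> \<longleftrightarrow> positive_op H \<rho> \<and> trace_class H \<rho> \<and> op_trace H \<rho> = 1"

section \<open>Quantum channels\<close>

text \<open>
  \<^term>\<open>T\<close> represents an \<open>n \<times> n\<close> operator matrix, acting on the \<open>n\<close>-fold direct sum of the space.
\<close>

definition positive_block :: "nat \<Rightarrow> (nat \<Rightarrow> nat \<Rightarrow> 's \<Rightarrow> 's::chilbert_space) \<Rightarrow> bool" where
  "positive_block n T \<longleftrightarrow> (\<forall>x. (\<Sum>i<n. \<Sum>j<n. cinner (x i) (T i j (x j))) \<in> \<real>\<^sub>\<ge>\<^sub>0)"

definition completely_positive :: "(('s \<Rightarrow> 's) \<Rightarrow> 's \<Rightarrow> 's::chilbert_space) \<Rightarrow> bool" where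
  "completely_positive \<E> \<longleftrightarrow>
    (\<forall>n T. (\<forall>i<n. \<forall>j<n. trace_class UNIV (T i j)) \<longrightarrow> positive_block n T \<longrightarrow>
      positive_block n (\<lambda>i j. \<E> (T i j)))"

text \<open>Only the restriction of \<open>\<E>\<close> to the trace-class operators is relevant.\<close>

definition quantum_channel :: "(('s \<Rightarrow> 's) \<Rightarrow> 's \<Rightarrow> 's::chilbert_space) \<Rightarrow> bool" where
  "quantum_channel \<E> \<longleftrightarrow>
    (\<forall>A. trace_class UNIV A \<longrightarrow> trace_class UNIV (\<E> A)) \<and>
    (\<forall>A B a b. trace_class UNIV A \<longrightarrow> trace_class UNIV B \<longrightarrow>
      \<E> (\<lambda>x. a *\<^sub>C A x + b *\<^sub>C B x) = (\<lambda>x. a *\<^sub>C \<E> A x + b *\<^sub>C \<E> B x)) \<and>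
    completely_positive \<E> \<and>
    (\<forall>A. trace_class UNIV A \<longrightarrow> op_trace UNIV (\<E> A) = op_trace UNIV A)"

section \<open>Tensor products and partial traces\<close>

text \<open>
  The Hilbert space tensor product of \<open>HM\<close> and \<open>HS\<close> is characterised, up to a unique unitary
  compatible with the elementary tensors, as a Hilbert space \<open>K\<close> with a bilinear map
  satisfying the following properties.
\<close>

locale hilbert_tensor_product =
  fixes HM :: "'m::chilbert_space set"
    and HS :: "'s::chilbert_space set"
    and K :: "'k::chilbert_space set"
    and tensor :: "'m \<Rightarrow> 's \<Rightarrow> 'k"
  assumes hilbert_M: "separable_hilbert_space HM"
    and hilbert_S: "separable_hilbert_space HS"
    and hilbert_K: "separable_hilbert_space K"
    and tensor_add_left:
      "a \<in> HM \<Longrightarrow> b \<in> HM \<Longrightarrow> x \<in> HS \<Longrightarrow> tensor (a + b) x = tensor a x + tensor b x"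
    and tensor_add_right:
      "a \<in> HM \<Longrightarrow> x \<in> HS \<Longrightarrow> y \<in> HS \<Longrightarrow> tensor a (x + y) = tensor a x + tensor a y"
    and tensor_scaleC_left:
      "a \<in> HM \<Longrightarrow> x \<in> HS \<Longrightarrow> tensor (c *\<^sub>C a) x = c *\<^sub>C tensor a x"
    and tensor_scaleC_right:
      "a \<in> HM \<Longrightarrow> x \<in> HS \<Longrightarrow> tensor a (c *\<^sub>C x) = c *\<^sub>C tensor a x"
    and cinner_tensor:
      "a \<in> HM \<Longrightarrow> b \<in> HM \<Longrightarrow> x \<in> HS \<Longrightarrow> y \<in> HS \<Longrightarrow>
        cinner (tensor a x) (tensor b y) = cinner a b * cinner x y"
    and tensor_dense:
      "closure (module.span (*\<^sub>C) {tensor a x | a x. a \<in> HM \<and> x \<in> HS}) = K"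
begin

definition op_tensor :: "('m \<Rightarrow> 'm) \<Rightarrow> ('s \<Rightarrow> 's) \<Rightarrow> 'k \<Rightarrow> 'k" where
  "op_tensor A B =
    (THE C. bounded_op K C \<and> (\<forall>a\<in>HM. \<forall>x\<in>HS. C (tensor a x) = tensor (A a) (B x)))"

definition partial_trace_M :: "('k \<Rightarrow> 'k) \<Rightarrow> 's \<Rightarrow> 's" where
  "partial_trace_M T =
    (THE R. bounded_op HS R \<and>
      (\<forall>x\<in>HS. \<forall>y\<in>HS.
        ((\<lambda>e. cinner (tensor e x) (T (tensor e y))) has_sum cinner x (R y)) (some_onb HM)))"

definition partial_trace_S :: "('k \<Rightarrow> 'k) \<Rightarrow> 'm \<Rightarrow> 'm" where
  "partial_trace_S T =
    (THE R. bounded_op HM R \<and>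
      (\<forall>a\<in>HM. \<forall>b\<in>HM.
        ((\<lambda>e. cinner (tensor a e) (T (tensor b e))) has_sum cinner a (R b)) (some_onb HS)))"

end

section \<open>Repeatable channels\<close>

locale memory_device = hilbert_tensor_product HM HS K tensor
  for HM :: "'m::chilbert_space set"
    and HS :: "'s::chilbert_space set"
    and K :: "'k::chilbert_space set"
    and tensor :: "'m \<Rightarrow> 's \<Rightarrow> 'k" +
  fixes U :: "'k \<Rightarrow> 'k"
    and \<xi> :: "'m \<Rightarrow> 'm"
  assumes unitary: "unitary_op K U"
    and initial_memory: "density_op HM \<xi>"
begin

text \<open>
  Uses of the device are numbered from \<open>0\<close>: \<open>memory_state \<rho> j\<close> is the state of the memory
  just before the input \<open>\<rho> j\<close> is processed.
\<close>

primrec memory_state :: "(nat \<Rightarrow> 's \<Rightarrow> 's) \<Rightarrow> nat \<Rightarrow> 'm \<Rightarrow> 'm" where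
  "memory_state \<rho> 0 = \<xi>"
| "memory_state \<rho> (Suc j) =
    partial_trace_S (conjugate_by K U (op_tensor (memory_state \<rho> j) (\<rho> j)))"

definition induced_channel :: "(nat \<Rightarrow> 's \<Rightarrow> 's) \<Rightarrow> nat \<Rightarrow> ('s \<Rightarrow> 's) \<Rightarrow> 's \<Rightarrow> 's" where
  "induced_channel \<rho> j A =
    partial_trace_M (conjugate_by K U (op_tensor (memory_state \<rho> j) A))"

end

text \<open>
  A separable Hilbert space is isometrically isomorphic to a closed subspace of \<^typ>\<open>complex ell2\<close>,
  and its tensor product with a separable Hilbert space \<^typ>\<open>'s\<close> to a closed subspace of
  \<^typ>\<open>'s ell2\<close>. Hence letting \<open>HM\<close> and \<open>K\<close> range over the closed subspaces of these two types
  amounts to quantifying over all separable memory spaces and all tensor products.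
\<close>

definition repeatable :: "(('s \<Rightarrow> 's) \<Rightarrow> 's \<Rightarrow> 's::chilbert_space) \<Rightarrow> bool" where
  "repeatable \<E> \<longleftrightarrow> quantum_channel \<E> \<and>
    (\<exists>(HM :: complex ell2 set) (K :: 's ell2 set) tensor U \<xi>.
      memory_device HM UNIV K tensor U \<xi> \<and>
      (\<forall>\<rho>. (\<forall>j. density_op UNIV (\<rho> j)) \<longrightarrow>
        (\<forall>j A. trace_class UNIV A \<longrightarrow>
          memory_device.induced_channel HM UNIV K tensor U \<xi> \<rho> j A = \<E> A)))"

text \<open>
  The series converges absolutely in trace norm; it is enough to determine its sum in the strong
  operator topology.
\<close>

definition random_unitary ::
  "'i set \<Rightarrow> ('i \<Rightarrow> real) \<Rightarrow> ('i \<Rightarrow> 's \<Rightarrow> 's) \<Rightarrow> (('s \<Rightarrow> 's) \<Rightarrow> 's \<Rightarrow> 's::chilbert_space) \<Rightarrow> bool" where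
  "random_unitary J p U \<E> \<longleftrightarrow>
    countable J \<and> (\<forall>j\<in>J. 0 \<le> p j \<and> p j \<le> 1) \<and> (p has_sum 1) J \<and>
    (\<forall>j\<in>J. unitary_op UNIV (U j)) \<and>
    (\<forall>A. trace_class UNIV A \<longrightarrow>
      (\<forall>x. ((\<lambda>j. p j *\<^sub>R conjugate_by UNIV (U j) A x) has_sum \<E> A x) J))"

end

theory Submission
  imports Defs
begin

text \<open>
  The memory is \<open>\<ell>\<^sup>2\<close> with the diagonal state \<open>\<xi> = diag (p\<^sub>n)\<close>, the composite space is the space of
  square-summable sequences in \<open>H\<^sub>S\<close>, and the device is the controlled unitary
  \<open>U = \<Sum>\<^sub>n |n\<rangle>\<langle>n| \<otimes> U\<^sub>n\<close>. Then \<open>U (\<xi> \<otimes> \<rho>) U\<^sup>\<dagger>\<close> is block diagonal with blocks \<open>p\<^sub>n U\<^sub>n \<rho> U\<^sub>n\<^sup>\<dagger>\<close>. Its partial trace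
  over the system is \<open>\<xi>\<close> again, as the blocks have trace \<open>p\<^sub>n\<close>, so the memory state never changes; its
  partial trace over the memory is \<open>\<Sum>\<^sub>n p\<^sub>n U\<^sub>n \<rho> U\<^sub>n\<^sup>\<dagger>\<close>.
\<close>

section \<open>Inner products and operators\<close>

text \<open>Reusing the memory may correlate the outputs of different uses, and after a use memory
  and system may be correlated too. Repeatability concerns only the channel of each single use, and
  the recursion keeps only the reduced memory state. The analytic obstacle is that the trace is a
  sum over one chosen basis \<open>some_onb\<close>. Evaluating a block conjugated by
  \<open>V n\<close> in that basis means evaluating the input state in the basis moved by
  \<open>inv (V n)\<close>, so the claim that the blocks have the right trace rests on basis
  independence. It suffices to have it for positive operators, since these span the trace class.
  There the form is expanded into squared moduli |<v i, x>|^2, and every diagonal sum becomes the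
  sum of the squared norms of the \<open>v i\<close>. Adjoints, operator tensors and partial traces
  are definite descriptions: each evaluation exhibits a candidate and proves it unique.\<close>

instance chilbert_space \<subseteq> banach ..

text \<open>The definitions speak of complex spans through \<open>module.span\<close>; the
  interpretation provides the span calculus for them as \<open>cvec.span\<close>.\<close>

interpretation cvec: vector_space "scaleC :: complex \<Rightarrow> 'a \<Rightarrow> 'a::complex_inner"
  by standard (simp_all add: scaleC_add_right scaleC_add_left scaleC_scaleC)

lemma cinner_zero [simp]: "cinner x 0 = 0" "cinner 0 x = 0" for x :: "'a::complex_inner"
  using cinner_scaleC_right[of x 0 0] cinner_scaleC_left[of 0 0 x] by simp_all

lemma cinner_scaleR: "cinner (r *\<^sub>R x) y = of_real r * cinner x y"
  "cinner x (r *\<^sub>R y) = of_real r * cinner x y" for x :: "'a::complex_inner"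
  by (simp_all add: scaleC_of_real[symmetric] cinner_scaleC_right cinner_scaleC_left)

lemma cinner_minus: "cinner (- x) y = - cinner x y" "cinner x (- y) = - cinner x y"
  for x :: "'a::complex_inner"
  using cinner_scaleR(1)[of "-1" x y] cinner_scaleR(2)[of x "-1" y] by simp_all

lemma cinner_diff: "cinner (x - y) z = cinner x z - cinner y z"
  "cinner x (y - z) = cinner x y - cinner x z" for x :: "'a::complex_inner"
  using cinner_add_left[of x "- y" z] cinner_add_right[of x y "- z"] by (simp_all add: cinner_minus)

lemma cinner_sum_left: "cinner (sum f A) y = (\<Sum>i\<in>A. cinner (f i) y)" for y :: "'a::complex_inner"
  by (induction A rule: infinite_finite_induct) (simp_all add: cinner_add_left)

lemma cinner_sum_right: "cinner y (sum f A) = (\<Sum>i\<in>A. cinner y (f i))" for y :: "'a::complex_inner"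
  by (induction A rule: infinite_finite_induct) (simp_all add: cinner_add_right)

lemma scaleR_scaleC_commute: "r *\<^sub>R c *\<^sub>C x = c *\<^sub>C r *\<^sub>R x" for x :: "'a::complex_inner"
  by (simp add: scaleC_of_real[symmetric] scaleC_scaleC mult.commute)

lemma cinner_eq_norm: "cmod (cinner x x) = (norm x)\<^sup>2" for x :: "'a::complex_inner"
  unfolding cinner_self by (simp only: norm_of_real) simp

text \<open>The additive bound \<open>norm_cinner_le\<close>, applied to the normalised vectors,
  gives 1 on the right-hand side.\<close>

lemma Cauchy_Schwarz: "norm (cinner x y) \<le> norm x * norm y" for x :: "'a::complex_inner"
proof (cases "x = 0 \<or> y = 0")
  case False
  then have "norm (cinner (x /\<^sub>R norm x) (y /\<^sub>R norm y)) \<le> 1"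
    using norm_cinner_le[of "x /\<^sub>R norm x" "y /\<^sub>R norm y"] by simp
  with False show ?thesis
    by (simp add: cinner_scaleR norm_mult norm_divide divide_simps mult.commute)
qed auto

lemma bounded_bilinear_cinner:
  "bounded_bilinear (cinner :: 'a::complex_inner \<Rightarrow> 'a \<Rightarrow> complex)"
proof
  show "\<exists>K. \<forall>(a::'a) b. norm (cinner a b) \<le> norm a * norm b * K"
    by (rule exI[of _ 1]) (simp add: Cauchy_Schwarz)
qed (simp_all add: cinner_add_left cinner_add_right cinner_scaleR scaleR_conv_of_real)

lemmas bounded_linear_cinner_right = bounded_bilinear.bounded_linear_right[OF bounded_bilinear_cinner]

lemma bounded_linear_scaleC: "bounded_linear (\<lambda>x :: 'a::complex_inner. c *\<^sub>C x)"
  by (intro bounded_linear_intro[where K = "norm c"])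
    (simp_all add: scaleC_add_right scaleR_scaleC_commute norm_scaleC mult.commute)

lemma cinner_ext: "x = y" if "\<And>z. cinner z x = cinner z y" for x y :: "'a::complex_inner"
proof -
  have "cinner (x - y) (x - y) = 0" by (simp add: cinner_diff(2) that)
  then show ?thesis by (simp add: cinner_self)
qed

lemma bounded_op_UNIV:
  "bounded_op UNIV A \<longleftrightarrow> (\<forall>x y. A (x + y) = A x + A y) \<and> (\<forall>c x. A (c *\<^sub>C x) = c *\<^sub>C A x) \<and>
    (\<exists>C. \<forall>x. norm (A x) \<le> C * norm x)"
  unfolding bounded_op_def by auto

lemma bounded_op_bounded_linear: "bounded_linear A" if "bounded_op UNIV A"
proof -
  from that obtain C where A: "\<And>x y. A (x + y) = A x + A y" "\<And>c x. A (c *\<^sub>C x) = c *\<^sub>C A x"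
    and C: "\<And>x. norm (A x) \<le> C * norm x"
    unfolding bounded_op_UNIV by auto
  show ?thesis
    using C A by (intro bounded_linear_intro[where K = C]) (simp_all add: scaleC_of_real[symmetric] mult.commute)
qed

lemma bounded_opI:
  assumes "bounded_linear A" "\<And>c x. A (c *\<^sub>C x) = c *\<^sub>C A x"
  shows "bounded_op UNIV A"
  using bounded_linear.bounded[OF assms(1)] assms(2) linear_add[OF bounded_linear.linear[OF assms(1)]]
  unfolding bounded_op_UNIV by (auto simp: mult.commute)

lemma bounded_op_scaleC: "A (c *\<^sub>C x) = c *\<^sub>C A x" if "bounded_op UNIV A"
  using that unfolding bounded_op_UNIV by blast

lemma bounded_op_lincomb:
  assumes "bounded_op UNIV A" "bounded_op UNIV B"
  shows "bounded_op UNIV (\<lambda>x. a *\<^sub>C A x + b *\<^sub>C B x)"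
proof (rule bounded_opI)
  show "bounded_linear (\<lambda>x. a *\<^sub>C A x + b *\<^sub>C B x)"
    by (intro bounded_linear_add bounded_linear_compose[OF bounded_linear_scaleC]
        bounded_op_bounded_linear assms)
qed (simp add: bounded_op_scaleC[OF assms(1)] bounded_op_scaleC[OF assms(2)] scaleC_add_right
    scaleC_scaleC mult.commute)

lemma bounded_op_compose:
  assumes "bounded_op UNIV A" "bounded_op UNIV B"
  shows "bounded_op UNIV (\<lambda>x. A (B x))"
proof (rule bounded_opI)
  show "bounded_linear (\<lambda>x. A (B x))"
    using assms by (intro bounded_linear_compose[of A B] bounded_op_bounded_linear)
qed (simp add: bounded_op_scaleC[OF assms(1)] bounded_op_scaleC[OF assms(2)])

lemma norm_eq_if_cinner_eq: "norm x = norm y" if "cinner x x = cinner y y"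
  for x :: "'a::complex_inner" and y :: "'b::complex_inner"
  using that cinner_eq_norm[of x] cinner_eq_norm[of y] by simp

lemma unitary_norm: "norm (U x) = norm x" if "unitary_op UNIV U"
  for U :: "'a::chilbert_space \<Rightarrow> 'a"
  using that unfolding unitary_op_def by (intro norm_eq_if_cinner_eq) simp

lemma unitary_bij: "bij U" if "unitary_op UNIV U" for U :: "'a::chilbert_space \<Rightarrow> 'a"
proof -
  note unitary_norm[OF that]
  moreover have "linear U"
    using that bounded_op_bounded_linear bounded_linear.linear unfolding unitary_op_def by blast
  ultimately have "inj U" by (metis linear_injective_0 norm_eq_zero)
  with that show ?thesis unfolding unitary_op_def bij_def by blast
qed

lemma unitary_inv: "unitary_op UNIV (inv U)" if "unitary_op UNIV U"
  for U :: "'a::chilbert_space \<Rightarrow> 'a"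
proof -
  note b = unitary_bij[OF that]
  have U: "\<And>x y. cinner (U x) (U y) = cinner x y" and lin: "bounded_op UNIV U"
    using that unfolding unitary_op_def by auto
  note Ui = surj_f_inv_f[OF bij_is_surj[OF b]] inv_f_f[OF bij_is_inj[OF b]]
  have ci: "cinner (inv U x) (inv U y) = cinner x y" for x y
    by (metis U Ui(1))
  have "inv U (x + y) = inv U x + inv U y" for x y
  proof -
    have "U (inv U x + inv U y) = x + y"
      using lin by (simp add: bounded_op_UNIV Ui)
    then show ?thesis using Ui(2) by metis
  qed
  moreover have "inv U (c *\<^sub>C x) = c *\<^sub>C inv U x" for c x
  proof -
    have "U (c *\<^sub>C inv U x) = c *\<^sub>C x"
      by (simp add: bounded_op_scaleC[OF lin] Ui)
    then show ?thesis using Ui(2) by metis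
  qed
  moreover have "norm (inv U x) = norm x" for x
    by (intro norm_eq_if_cinner_eq ci)
  then have "\<forall>x. norm (inv U x) \<le> 1 * norm x" by simp
  ultimately have "bounded_op UNIV (inv U)" unfolding bounded_op_UNIV by blast
  with ci show ?thesis unfolding unitary_op_def using b by (simp add: bij_imp_bij_inv bij_is_surj)
qed

lemma cinner_unitary_left: "cinner x (U y) = cinner (inv U x) y" if "unitary_op UNIV U"
  for U :: "'a::chilbert_space \<Rightarrow> 'a"
proof -
  have "cinner (U (inv U x)) (U y) = cinner (inv U x) y"
    using that unfolding unitary_op_def by simp
  then show ?thesis using surj_f_inv_f[OF bij_is_surj[OF unitary_bij[OF that]]] by metis
qed

text \<open>Adjoints are only ever taken of unitaries. There the inverse is an explicit candidate,
  so no representation theorem is involved, and testing against all vectors shows that it is the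
  only one.\<close>

lemma adjoint_unitary: "adjoint_op UNIV U = inv U" if "unitary_op UNIV U"
  for U :: "'a::chilbert_space \<Rightarrow> 'a"
  unfolding adjoint_op_def
proof (rule the_equality)
  have ad: "cinner (U x) y = cinner x (inv U y)" for x y
    using cinner_unitary_left[OF that, of y x] cinner_commute by metis
  then show "bounded_op UNIV (inv U) \<and> (\<forall>x\<in>UNIV. \<forall>y\<in>UNIV. cinner (U x) y = cinner x (inv U y))"
    using unitary_inv[OF that] unfolding unitary_op_def by blast
  fix B assume "bounded_op UNIV B \<and> (\<forall>x\<in>UNIV. \<forall>y\<in>UNIV. cinner (U x) y = cinner x (B y))"
  then have B: "cinner x (B y) = cinner x (inv U y)" for x y by (metis ad UNIV_I)
  show "B = inv U" by (rule ext, rule cinner_ext) (rule B)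
qed

lemma conjugate_by_unitary: "conjugate_by UNIV U A = (\<lambda>x. U (A (inv U x)))"
  if "unitary_op UNIV U" for U :: "'a::chilbert_space \<Rightarrow> 'a"
  unfolding conjugate_by_def adjoint_unitary[OF that] by (auto simp: compose_def)

lemma conjugate_bounded: "bounded_op UNIV (\<lambda>x. U (A (inv U x)))"
  if "unitary_op UNIV U" "bounded_op UNIV A" for U :: "'a::chilbert_space \<Rightarrow> 'a"
proof -
  have "bounded_op UNIV U" "bounded_op UNIV (inv U)"
    using that unitary_inv[OF that(1)] unfolding unitary_op_def by auto
  then show ?thesis
    using bounded_op_compose[OF _ bounded_op_compose[OF that(2)]] by blast
qed

section \<open>Orthonormal bases\<close>

text \<open>Separability as an enumeration: both the Gram-Schmidt process and the elimination
  process for positive operators are recursions along such a sequence.\<close>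

definition dense_seq :: "(nat \<Rightarrow> 'a::real_normed_vector) \<Rightarrow> bool" where
  "dense_seq d \<longleftrightarrow> (\<forall>x. \<forall>\<epsilon>>0. \<exists>n. norm (x - d n) < \<epsilon>)"

lemma separable_hilbert_space_UNIV_iff:
  "separable_hilbert_space (UNIV :: 'a::chilbert_space set) \<longleftrightarrow> (\<exists>d :: nat \<Rightarrow> 'a. dense_seq d)"
proof
  assume "separable_hilbert_space (UNIV :: 'a set)"
  then obtain C :: "'a set" where C: "countable C" "closure C = UNIV"
    unfolding separable_hilbert_space_def separable_space_def by auto
  have "C \<noteq> {}" using C(2) by auto
  have "\<exists>n. norm (x - from_nat_into C n) < \<epsilon>" if "\<epsilon> > 0" for x :: 'a and \<epsilon>
  proof -
    have "x \<in> closure C" using C(2) by auto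
    with that obtain y where "y \<in> C" "dist y x < \<epsilon>"
      unfolding closure_approachable by auto
    moreover obtain n where "from_nat_into C n = y"
      using from_nat_into_surj[OF C(1) \<open>y \<in> C\<close>] by auto
    ultimately show ?thesis by (metis dist_commute dist_norm)
  qed
  then show "\<exists>d :: nat \<Rightarrow> 'a. dense_seq d" unfolding dense_seq_def by auto
next
  assume "\<exists>d :: nat \<Rightarrow> 'a. dense_seq d"
  then obtain d :: "nat \<Rightarrow> 'a" where d: "dense_seq d" by blast
  have "closure (range d) = UNIV"
    using d unfolding dense_seq_def closure_approachable set_eq_iff
    by (auto simp: closure_approachable dist_norm norm_minus_commute)
  then show "separable_hilbert_space (UNIV :: 'a set)"
    unfolding separable_hilbert_space_def separable_space_def
    by (auto intro!: exI[of _ "range d"])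
qed

definition orthonormal :: "'a::complex_inner set \<Rightarrow> bool" where
  "orthonormal B \<longleftrightarrow> (\<forall>x\<in>B. \<forall>y\<in>B. cinner x y = (if x = y then 1 else 0))"

lemma is_onb_UNIV:
  "is_onb UNIV B \<longleftrightarrow> orthonormal B \<and> closure (cvec.span B) = UNIV"
  for B :: "'a::chilbert_space set"
  unfolding is_onb_def orthonormal_def by auto

section \<open>Gram-Schmidt orthonormalisation and existence of bases\<close>

definition gs_residual :: "'a::complex_inner set \<Rightarrow> 'a \<Rightarrow> 'a" where
  "gs_residual B x = x - (\<Sum>e\<in>B. cinner e x *\<^sub>C e)"

lemma gs_residual_orthogonal:
  assumes "finite B" "orthonormal B" "e \<in> B"
  shows "cinner e (gs_residual B x) = 0"
proof -
  have "cinner e (\<Sum>e'\<in>B. cinner e' x *\<^sub>C e') = (\<Sum>e'\<in>B. if e = e' then cinner e' x else 0)"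
    unfolding cinner_sum_right using assms
    by (intro sum.cong) (auto simp: cinner_scaleC_right orthonormal_def)
  then show ?thesis using assms by (simp add: gs_residual_def cinner_diff)
qed

text \<open>The stages are sets rather than a sequence of vectors, because a vanishing residual
  contributes nothing; finite dimension is thereby included.\<close>

primrec gram_schmidt :: "(nat \<Rightarrow> 'a::complex_inner) \<Rightarrow> nat \<Rightarrow> 'a set" where
  "gram_schmidt d 0 = {}"
| "gram_schmidt d (Suc n) =
    (let r = gs_residual (gram_schmidt d n) (d n)
     in gram_schmidt d n \<union> (if r = 0 then {} else {r /\<^sub>R norm r}))"

lemma gram_schmidt_orthonormal: "finite (gram_schmidt d n) \<and> orthonormal (gram_schmidt d n)"
proof (induction n)
  case (Suc n)
  define G r where "G = gram_schmidt d n" and "r = gs_residual (gram_schmidt d n) (d n)"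
  show ?case
  proof (cases "r = 0")
    case False
    have "cinner e (r /\<^sub>R norm r) = 0" if "e \<in> G" for e
      using gs_residual_orthogonal[of G e "d n"] Suc that by (simp add: G_def r_def cinner_scaleR)
    moreover from this have "cinner (r /\<^sub>R norm r) e = 0" if "e \<in> G" for e
      using that by (metis cinner_commute complex_cnj_zero)
    moreover have "cinner (r /\<^sub>R norm r) (r /\<^sub>R norm r) = 1"
      using False by (simp add: cinner_self)
    ultimately have "orthonormal (insert (r /\<^sub>R norm r) G)"
      using Suc unfolding orthonormal_def G_def[symmetric]
      by (smt (verit) insert_iff zero_neq_one)
    with Suc show ?thesis by (simp add: Let_def False G_def r_def[symmetric])
  qed (use Suc in \<open>simp add: Let_def r_def\<close>)
qed (simp add: orthonormal_def)

lemma gram_schmidt_span: "d n \<in> cvec.span (gram_schmidt d (Suc n))"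
proof -
  define G r where "G = gram_schmidt d n" and "r = gs_residual (gram_schmidt d n) (d n)"
  let ?G' = "gram_schmidt d (Suc n)"
  have G: "G \<subseteq> ?G'" by (auto simp: G_def Let_def)
  have "r \<in> cvec.span ?G'"
  proof (cases "r = 0")
    case False
    then have "r /\<^sub>R norm r \<in> ?G'" by (simp add: Let_def r_def[symmetric])
    then have "complex_of_real (norm r) *\<^sub>C (r /\<^sub>R norm r) \<in> cvec.span ?G'"
      by (intro cvec.span_scale cvec.span_base)
    then show ?thesis using False by (simp add: scaleC_of_real)
  qed (simp add: cvec.span_zero)
  moreover have "(\<Sum>e\<in>G. cinner e (d n) *\<^sub>C e) \<in> cvec.span ?G'"
    using G by (intro cvec.span_sum cvec.span_scale cvec.span_base) auto
  moreover have "d n = r + (\<Sum>e\<in>G. cinner e (d n) *\<^sub>C e)"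
    by (simp add: r_def G_def gs_residual_def)
  ultimately show ?thesis by (metis cvec.span_add)
qed

text \<open>The stages are nested, so any two vectors of the union share an orthonormal stage, and
  the span of the union contains the dense sequence. Existence is what gives meaning to the choice
  \<open>some_onb\<close>.\<close>

lemma onb_exists:
  assumes "dense_seq (d :: nat \<Rightarrow> 'a::chilbert_space)"
  shows "\<exists>B :: 'a set. is_onb UNIV B"
proof (intro exI, unfold is_onb_UNIV, intro conjI)
  let ?B = "\<Union>n. gram_schmidt d n"
  have mono: "gram_schmidt d m \<subseteq> gram_schmidt d n" if "m \<le> n" for m n
    by (rule lift_Suc_mono_le[OF _ that]) (auto simp: Let_def)
  show "orthonormal ?B"
    unfolding orthonormal_def
  proof (intro ballI)
    fix x y assume "x \<in> ?B" "y \<in> ?B"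
    then obtain m n where "x \<in> gram_schmidt d m" "y \<in> gram_schmidt d n" by auto
    then have "x \<in> gram_schmidt d (max m n)" "y \<in> gram_schmidt d (max m n)"
      using mono[of m "max m n"] mono[of n "max m n"] by auto
    then show "cinner x y = (if x = y then 1 else 0)"
      using gram_schmidt_orthonormal[of d "max m n"] unfolding orthonormal_def by blast
  qed
  have "d n \<in> cvec.span ?B" for n
    using gram_schmidt_span cvec.span_mono[of "gram_schmidt d (Suc n)" ?B] by blast
  then show "closure (cvec.span ?B) = UNIV"
    using assms unfolding dense_seq_def closure_approachable set_eq_iff
    by (auto simp: closure_approachable dist_norm norm_minus_commute) (metis norm_minus_commute)
qed

lemma some_onb: "is_onb UNIV (some_onb (UNIV :: 'a::chilbert_space set))"
  if "separable_hilbert_space (UNIV :: 'a set)"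
  unfolding some_onb_def using onb_exists that
  by (intro someI_ex[of "is_onb UNIV"]) (auto simp: separable_hilbert_space_UNIV_iff)

text \<open>Completing the square in the coefficients. Fourier coefficients as \<open>c\<close>
  yield Bessel's inequality, and the coefficients of an arbitrary approximant yield the lower bound
  in Parseval's identity.\<close>

lemma orthonormal_residual_norm:
  assumes "finite F" "orthonormal F"
  shows "(norm (x - (\<Sum>e\<in>F. c e *\<^sub>C e)))\<^sup>2
    = (norm x)\<^sup>2 - (\<Sum>e\<in>F. (cmod (cinner e x))\<^sup>2) + (\<Sum>e\<in>F. (cmod (cinner e x - c e))\<^sup>2)"
proof -
  let ?s = "\<Sum>e\<in>F. c e *\<^sub>C e"
  have 1: "cinner x ?s = (\<Sum>e\<in>F. cnj (cinner e x) * c e)"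
    by (simp add: cinner_sum_right cinner_scaleC_right cinner_commute[of x] mult.commute)
  have 2: "cinner ?s x = (\<Sum>e\<in>F. cnj (c e) * cinner e x)"
    by (simp add: cinner_sum_left cinner_scaleC_left)
  have "cinner e ?s = c e" if "e \<in> F" for e
  proof -
    have "cinner e ?s = (\<Sum>e'\<in>F. if e = e' then c e' else 0)"
      unfolding cinner_sum_right using assms that
      by (intro sum.cong) (auto simp: cinner_scaleC_right orthonormal_def)
    then show ?thesis using that assms by simp
  qed
  then have 3: "cinner ?s ?s = (\<Sum>e\<in>F. cnj (c e) * c e)"
    unfolding cinner_sum_left[of _ F ?s] by (intro sum.cong) (auto simp: cinner_scaleC_left)
  have "cinner (x - ?s) (x - ?s)
      = cinner x x - (\<Sum>e\<in>F. cnj (cinner e x) * cinner e x)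
        + (\<Sum>e\<in>F. cnj (cinner e x - c e) * (cinner e x - c e))"
    unfolding cinner_diff 1 2 3
    by (simp add: algebra_simps sum.distrib sum_subtractf)
  moreover have "cnj z * z = complex_of_real ((cmod z)\<^sup>2)" for z
    using complex_norm_square[of z] by (simp add: mult.commute)
  ultimately have "complex_of_real ((norm (x - ?s))\<^sup>2) = complex_of_real ((norm x)\<^sup>2
      - (\<Sum>e\<in>F. (cmod (cinner e x))\<^sup>2) + (\<Sum>e\<in>F. (cmod (cinner e x - c e))\<^sup>2))"
    by (simp only: cinner_self of_real_add of_real_diff of_real_sum)
  then show ?thesis using of_real_eq_iff by blast
qed

lemma Bessel:
  assumes "finite F" "orthonormal F"
  shows "(\<Sum>e\<in>F. (cmod (cinner e x))\<^sup>2) \<le> (norm x)\<^sup>2"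
  using orthonormal_residual_norm[OF assms, of x "\<lambda>e. cinner e x"]
    zero_le_power2[of "norm (x - (\<Sum>e\<in>F. cinner e x *\<^sub>C e))"] by simp

text \<open>Bessel bounds all finite sums from above. An approximant from the span, with
  coefficients on a finite \<open>F\<close>, bounds the sum over \<open>F\<close> from below, and
  enlarging \<open>F\<close> only increases it.\<close>

lemma Parseval:
  assumes "is_onb UNIV B"
  shows "((\<lambda>e. (cmod (cinner e x))\<^sup>2) has_sum (norm x)\<^sup>2) B"
proof -
  have on: "orthonormal B" and cl: "x \<in> closure (cvec.span B)"
    using assms unfolding is_onb_UNIV by auto
  have onF: "orthonormal F" if "F \<subseteq> B" for F
    using on that unfolding orthonormal_def by blast
  have bd: "(\<Sum>e\<in>F. (cmod (cinner e x))\<^sup>2) \<le> (norm x)\<^sup>2" if "finite F" "F \<subseteq> B" for F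
    using Bessel[OF that(1) onF[OF that(2)]] .
  have "\<exists>F. finite F \<and> F \<subseteq> B \<and> (\<forall>Y. finite Y \<and> F \<subseteq> Y \<and> Y \<subseteq> B \<longrightarrow>
      dist (\<Sum>e\<in>Y. (cmod (cinner e x))\<^sup>2) ((norm x)\<^sup>2) < \<epsilon>)" if "\<epsilon> > 0" for \<epsilon>
  proof -
    \<comment> \<open>The identity for residuals involves the squared distance, hence the root of
      \<epsilon>.\<close>
    obtain y where y: "y \<in> cvec.span B" "dist y x < sqrt \<epsilon>"
      using cl \<open>\<epsilon> > 0\<close> unfolding closure_approachable by (meson real_sqrt_gt_0_iff)
    then obtain F c where F: "finite F" "F \<subseteq> B" "y = (\<Sum>e\<in>F. c e *\<^sub>C e)"
      unfolding cvec.span_explicit by auto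
    have "(norm (x - y))\<^sup>2 < \<epsilon>"
      using y(2) \<open>\<epsilon> > 0\<close> by (metis dist_commute dist_norm norm_ge_zero real_sqrt_less_iff real_sqrt_abs abs_of_nonneg)
    moreover have "0 \<le> (\<Sum>e\<in>F. (cmod (cinner e x - c e))\<^sup>2)" by (intro sum_nonneg) auto
    ultimately have low: "(norm x)\<^sup>2 - \<epsilon> < (\<Sum>e\<in>F. (cmod (cinner e x))\<^sup>2)"
      unfolding F(3) orthonormal_residual_norm[OF F(1) onF[OF F(2)]] by linarith
    have "dist (\<Sum>e\<in>Y. (cmod (cinner e x))\<^sup>2) ((norm x)\<^sup>2) < \<epsilon>"
      if "finite Y" "F \<subseteq> Y" "Y \<subseteq> B" for Y
    proof -
      have "(\<Sum>e\<in>F. (cmod (cinner e x))\<^sup>2) \<le> (\<Sum>e\<in>Y. (cmod (cinner e x))\<^sup>2)"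
        using that by (intro sum_mono2) auto
      with low bd[OF that(1,3)] show ?thesis by (simp add: dist_real_def)
    qed
    with F show ?thesis by blast
  qed
  then show ?thesis
    unfolding has_sum_def tendsto_iff eventually_finite_subsets_at_top by blast
qed

text \<open>Allows a unitary to be moved from the operator to the basis when a trace is
  computed.\<close>

lemma onb_unitary_image:
  assumes "is_onb UNIV B" "unitary_op UNIV U"
  shows "is_onb UNIV (U ` B)"
proof -
  have U: "\<And>x y. cinner (U x) (U y) = cinner x y" and lin: "bounded_op UNIV U"
    using assms(2) unfolding unitary_op_def by auto
  note bij = unitary_bij[OF assms(2)]
  have on: "orthonormal B" and cl: "closure (cvec.span B) = UNIV"
    using assms(1) unfolding is_onb_UNIV by auto
  have "orthonormal (U ` B)"
    using on bij_is_inj[OF bij] unfolding orthonormal_def by (auto simp: U inj_eq)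
  moreover have "U y \<in> cvec.span (U ` B)" if "y \<in> cvec.span B" for y
    using that
  proof (induction rule: cvec.span_induct_alt)
    case base
    then show ?case using bounded_linear.linear[OF bounded_op_bounded_linear[OF lin]]
      by (simp add: linear_0 cvec.span_zero)
  next
    case (step c x y)
    then show ?case using lin
      by (simp add: bounded_op_UNIV cvec.span_add cvec.span_scale cvec.span_base)
  qed
  then have "x \<in> closure (cvec.span (U ` B))" for x
  proof (unfold closure_approachable, intro allI impI)
    fix \<epsilon> :: real assume "\<epsilon> > 0"
    \<comment> \<open>Density is pulled back: an approximation of \<open>inv U x\<close> is carried
      by \<open>U\<close> to one of \<open>x\<close> with the same error.\<close>
    then obtain y where y: "y \<in> cvec.span B" "dist y (inv U x) < \<epsilon>"
      using cl closure_approachable by blast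
    have "U y - x = U (y - inv U x)"
      using bounded_linear.linear[OF bounded_op_bounded_linear[OF lin]] bij
      by (simp add: linear_diff bij_is_surj surj_f_inv_f)
    then have "dist (U y) x < \<epsilon>"
      using y(2) by (simp add: dist_norm unitary_norm[OF assms(2)])
    with \<open>\<And>y. y \<in> cvec.span B \<Longrightarrow> U y \<in> cvec.span (U ` B)\<close>[OF y(1)]
    show "\<exists>y\<in>cvec.span (U ` B). dist y x < \<epsilon>" by blast
  qed
  ultimately show ?thesis unfolding is_onb_UNIV by auto
qed

section \<open>Exchanging unconditional sums\<close>

text \<open>Fubini: absolute summability makes the double family summable, and both iterated sums
  then compute its total. Convergence of the sum of \<open>h\<close> is part of the
  conclusion.\<close>

lemma has_sum_exchange:
  fixes f :: "'a \<Rightarrow> 'b \<Rightarrow> 'c::banach"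
  assumes abs: "(\<lambda>(x, y). norm (f x y)) summable_on A \<times> B"
    and f: "\<And>x. x \<in> A \<Longrightarrow> (f x has_sum g x) B" and g: "(g has_sum t) A"
    and h: "\<And>y. y \<in> B \<Longrightarrow> ((\<lambda>x. f x y) has_sum h y) A"
  shows "(h has_sum t) B"
proof -
  have "(\<lambda>z. norm (case_prod f z)) summable_on A \<times> B"
    using abs by (simp add: case_prod_unfold)
  then have "case_prod f summable_on A \<times> B" by (rule abs_summable_summable)
  then have "(case_prod f has_sum t) (A \<times> B)"
    by (intro has_sum_SigmaI[OF _ g]) (simp_all add: f)
  then have "((\<lambda>(y, x). f x y) has_sum t) (B \<times> A)"
    by (subst (asm) has_sum_swap) simp
  then show ?thesis by (rule has_sum_SigmaD) (simp add: h)
qed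

text \<open>The Tonelli half, which supplies the absolute summability that the exchange asks
  for.\<close>

lemma nonneg_summable_on_Times:
  fixes f :: "'a \<Rightarrow> 'b \<Rightarrow> real"
  assumes "\<And>x y. x \<in> A \<Longrightarrow> y \<in> B \<Longrightarrow> 0 \<le> f x y"
    and "\<And>x. x \<in> A \<Longrightarrow> (f x has_sum g x) B" and "g summable_on A"
  shows "(\<lambda>(x, y). f x y) summable_on A \<times> B"
  using assms by (intro summable_on_SigmaI[where g = g]) auto

lemma has_sum_exchange_nonneg:
  fixes f :: "'a \<Rightarrow> 'b \<Rightarrow> real"
  assumes nonneg: "\<And>x y. x \<in> A \<Longrightarrow> y \<in> B \<Longrightarrow> 0 \<le> f x y"
    and f: "\<And>x. x \<in> A \<Longrightarrow> (f x has_sum g x) B" and g: "(g has_sum t) A"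
    and h: "\<And>y. y \<in> B \<Longrightarrow> ((\<lambda>x. f x y) has_sum h y) A"
  shows "(h has_sum t) B"
proof (rule has_sum_exchange[OF _ f g h])
  have "(\<lambda>(x, y). norm (f x y)) summable_on A \<times> B \<longleftrightarrow> (\<lambda>(x, y). f x y) summable_on A \<times> B"
    by (rule summable_on_cong) (auto simp: nonneg)
  then show "(\<lambda>(x, y). norm (f x y)) summable_on A \<times> B"
    using nonneg_summable_on_Times[OF nonneg f has_sum_imp_summable[OF g]] by simp
qed

section \<open>Positive operators as sums of rank-one operators\<close>

context
  fixes P :: "'a::chilbert_space \<Rightarrow> 'a"
  assumes pos: "positive_op UNIV P"
begin

lemma positive_bounded: "bounded_op UNIV P"
  using pos unfolding positive_op_def by blast

lemma positive_form: "0 \<le> Re (cinner x (P x))" "Im (cinner x (P x)) = 0"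
  using pos unfolding positive_op_def complex_nonneg_Reals_iff by auto

lemma positive_add: "P (x + y) = P x + P y"
  using positive_bounded unfolding bounded_op_UNIV by blast

lemmas positive_scaleC = bounded_op_scaleC[OF positive_bounded]

text \<open>Polarisation: the form is real at \<open>x + y\<close>, which compares imaginary parts,
  and at x + \<i> y, which compares real parts.\<close>

lemma positive_hermitian: "cinner x (P y) = cnj (cinner y (P x))"
proof (rule complex_eqI)
  have "Im (cinner (x + y) (P (x + y))) = 0" by (rule positive_form)
  then show "Im (cinner x (P y)) = Im (cnj (cinner y (P x)))"
    by (simp add: positive_add cinner_add_left cinner_add_right positive_form)
  have "Im (cinner (x + \<i> *\<^sub>C y) (P (x + \<i> *\<^sub>C y))) = 0" by (rule positive_form)
  then show "Re (cinner x (P y)) = Re (cnj (cinner y (P x)))"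
    by (simp add: positive_add positive_scaleC cinner_add_left cinner_add_right cinner_scaleC_left
        cinner_scaleC_right positive_form)
qed

lemma positive_Cauchy_Schwarz:
  "(cmod (cinner x (P y)))\<^sup>2 \<le> Re (cinner x (P x)) * Re (cinner y (P y))"
proof -
  define a b d where "a = Re (cinner x (P x))" and "b = cinner x (P y)" and "d = Re (cinner y (P y))"
  have q: "0 \<le> a - 2 * t * (cmod b)\<^sup>2 + t\<^sup>2 * (cmod b)\<^sup>2 * d" for t :: real
  proof -
    \<comment> \<open>The factor \<open>cnj b\<close> makes the cross terms real; the real parameter
      \<open>t\<close> is chosen afterwards.\<close>
    define c where "c = - (of_real t * cnj b)"
    have yx: "cinner y (P x) = cnj b" unfolding b_def by (rule positive_hermitian)
    have "cinner (x + c *\<^sub>C y) (P (x + c *\<^sub>C y))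
        = cinner x (P x) + c * b + cnj (c * b) + cnj c * c * cinner y (P y)"
      unfolding positive_add positive_scaleC cinner_add_left cinner_add_right cinner_scaleC_left
        cinner_scaleC_right yx b_def by (simp add: algebra_simps)
    moreover have "c * b = - of_real (t * (cmod b)\<^sup>2)"
      using complex_norm_square[of b] by (simp add: c_def mult.commute)
    moreover have "cnj c * c = of_real (t\<^sup>2 * (cmod b)\<^sup>2)"
      using complex_norm_square[of b] by (simp add: c_def power2_eq_square algebra_simps)
    ultimately have "Re (cinner (x + c *\<^sub>C y) (P (x + c *\<^sub>C y)))
        = a - 2 * t * (cmod b)\<^sup>2 + t\<^sup>2 * (cmod b)\<^sup>2 * d"
      by (simp add: a_def d_def del: of_real_mult of_real_power)
    then show ?thesis using positive_form(1) by metis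
  qed
  have a: "0 \<le> a" and d: "0 \<le> d" unfolding a_def d_def by (rule positive_form)+
  have "(cmod b)\<^sup>2 \<le> a * d"
  proof (cases "d = 0")
    case True
    show ?thesis
    proof (rule ccontr)
      assume "\<not> ?thesis"
      then have "0 < (cmod b)\<^sup>2" using True by simp
      \<comment> \<open>For \<open>d = 0\<close> the bound is affine in \<open>t\<close>, and this
        choice gives it the negative value \<open>- a - 2\<close>.\<close>
      with q[of "(a + 1) / (cmod b)\<^sup>2"] True a show False by simp
    qed
  next
    case False
    with d have "0 < d" by simp
    \<comment> \<open>The vertex of the quadratic in \<open>t\<close>.\<close>
    with q[of "1 / d"] show ?thesis by (simp add: field_simps power2_eq_square)
  qed
  then show ?thesis unfolding a_def b_def d_def .
qed

end

text \<open>When \<open>cinner y (P y) = 0\<close> also \<open>P y = 0\<close>, and the vector below is \<open>0\<close>.\<close>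

definition schur_vec :: "('a::complex_inner \<Rightarrow> 'a) \<Rightarrow> 'a \<Rightarrow> 'a" where
  "schur_vec P y = P y /\<^sub>R sqrt (Re (cinner y (P y)))"

text \<open>One Cholesky elimination step: the Schur complement of \<open>P\<close> with respect to
  the direction \<open>y\<close>.\<close>

definition schur_step :: "('a::complex_inner \<Rightarrow> 'a) \<Rightarrow> 'a \<Rightarrow> 'a \<Rightarrow> 'a" where
  "schur_step P y = (\<lambda>x. P x - cinner (schur_vec P y) x *\<^sub>C schur_vec P y)"

lemma bounded_op_rank_one: "bounded_op UNIV (\<lambda>x. cinner v x *\<^sub>C v)"
proof (rule bounded_opI)
  show "bounded_linear (\<lambda>x. cinner v x *\<^sub>C v)"
  proof (rule bounded_linear_intro[where K = "norm v * norm v"])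
    fix x show "norm (cinner v x *\<^sub>C v) \<le> norm x * (norm v * norm v)"
      using mult_right_mono[OF Cauchy_Schwarz[of v x], of "norm v"]
      by (simp add: norm_scaleC mult_ac)
  qed (simp_all add: cinner_add_right scaleC_add_left cinner_scaleC_right scaleC_of_real[symmetric] scaleC_scaleC)
qed (simp add: cinner_scaleC_right scaleC_scaleC)

lemma cinner_mult_swap: "cinner v x * cinner x v = complex_of_real ((cmod (cinner v x))\<^sup>2)"
  using complex_norm_square[of "cinner v x"] cinner_commute[of x v] by metis

lemma schur_step_form:
  "cinner x (schur_step P y x) = cinner x (P x) - of_real ((cmod (cinner (schur_vec P y) x))\<^sup>2)"
  by (simp add: schur_step_def cinner_diff cinner_scaleC_right cinner_mult_swap del: of_real_power)

text \<open>This is the Cauchy-Schwarz inequality for the form of \<open>P\<close>, divided by the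
  value of the form at \<open>y\<close>.\<close>

lemma schur_step_positive:
  assumes "positive_op UNIV P" shows "positive_op UNIV (schur_step P y)"
proof -
  let ?d = "Re (cinner y (P y))"
  have "(cmod (cinner (schur_vec P y) x))\<^sup>2 \<le> Re (cinner x (P x))" for x
  proof (cases "?d = 0")
    case False
    have "(cmod (cinner (schur_vec P y) x))\<^sup>2 = (cmod (cinner (P y) x))\<^sup>2 / ?d"
      using positive_form(1)[OF assms, of y]
      by (simp add: schur_vec_def cinner_scaleR norm_mult norm_inverse power_mult_distrib
          power_inverse divide_inverse mult.commute)
    also have "\<dots> \<le> Re (cinner x (P x))"
      using positive_Cauchy_Schwarz[OF assms, of x y] positive_form(1)[OF assms, of y] False
        cinner_commute[of x "P y"] by (simp add: field_simps)
    finally show ?thesis .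
  qed (simp add: schur_vec_def positive_form(1)[OF assms])
  then have "cinner x (schur_step P y x) \<in> \<real>\<^sub>\<ge>\<^sub>0" for x
    unfolding complex_nonneg_Reals_iff schur_step_form
    by (simp add: positive_form[OF assms] del: of_real_power)
  moreover have "bounded_op UNIV (schur_step P y)"
    using bounded_op_lincomb[OF positive_bounded[OF assms] bounded_op_rank_one, of 1 "-1" "schur_vec P y"]
    by (simp add: schur_step_def)
  ultimately show ?thesis unfolding positive_op_def by simp
qed

text \<open>The subtracted term takes the value \<open>P y\<close> at \<open>y\<close>. If the form
  vanishes at \<open>y\<close>, Cauchy-Schwarz already forces \<open>P y = 0\<close>.\<close>

lemma schur_step_self: "schur_step P y y = 0" if "positive_op UNIV P"
proof (cases "Re (cinner y (P y)) = 0")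
  case True
  then have "cinner x (P y) = 0" for x
    using positive_Cauchy_Schwarz[OF that, of x y] by simp
  then have "P y = 0" using cinner_ext[of "P y" 0] by simp
  then show ?thesis by (simp add: schur_step_def schur_vec_def)
next
  case False
  let ?d = "Re (cinner y (P y))"
  have d: "?d > 0" using False positive_form(1)[OF that, of y] by simp
  have "cinner (P y) y = of_real ?d"
    using positive_hermitian[OF that, of y y] positive_form(2)[OF that, of y]
      cinner_commute[of "P y" y] by (simp add: complex_eq_iff)
  then have "cinner (schur_vec P y) y *\<^sub>C schur_vec P y
      = complex_of_real (?d / sqrt ?d / sqrt ?d) *\<^sub>C P y"
    unfolding schur_vec_def scaleC_of_real[symmetric] scaleC_scaleC cinner_scaleC_left
    by (simp add: divide_inverse mult_ac)
  also have "?d / sqrt ?d / sqrt ?d = 1" using d by simp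
  finally show ?thesis by (simp add: schur_step_def)
qed

text \<open>By Hermitian symmetry a kernel vector of \<open>P\<close> is orthogonal to the range of
  \<open>P\<close>, so directions eliminated earlier stay eliminated.\<close>

lemma schur_step_zero:
  assumes "positive_op UNIV P" "P x = 0" shows "schur_step P y x = 0"
proof -
  have "cinner (P y) x = 0"
    using positive_hermitian[OF assms(1), of x y] cinner_commute[of "P y" x] assms(2) by simp
  then show ?thesis by (simp add: schur_step_def schur_vec_def cinner_scaleR assms(2))
qed

primrec schur_rem :: "('a::complex_inner \<Rightarrow> 'a) \<Rightarrow> (nat \<Rightarrow> 'a) \<Rightarrow> nat \<Rightarrow> 'a \<Rightarrow> 'a" where
  "schur_rem P d 0 = P"
| "schur_rem P d (Suc k) = schur_step (schur_rem P d k) (d k)"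

lemma schur_rem_positive: "positive_op UNIV (schur_rem P d k)" if "positive_op UNIV P"
  by (induction k) (simp_all add: that schur_step_positive)

lemma schur_rem_zero: "schur_rem P d k (d j) = 0" if "positive_op UNIV P" "j < k"
  using that(2)
proof (induction k)
  case (Suc k)
  then show ?case
    using schur_step_self[OF schur_rem_positive[OF that(1)]]
      schur_step_zero[OF schur_rem_positive[OF that(1)]]
    by (cases "j = k") auto
qed simp

lemma schur_rem_form:
  "Re (cinner x (schur_rem P d k x))
    = Re (cinner x (P x)) - (\<Sum>i<k. (cmod (cinner (schur_vec (schur_rem P d i) (d i)) x))\<^sup>2)"
  by (induction k) (simp_all add: schur_step_form del: of_real_power)

text \<open>
  An infinite Cholesky decomposition. It avoids the square root of \<open>P\<close> in the proof that the trace
  does not depend on the basis. The remainders decrease and vanish at more and more members of a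
  dense sequence, so their forms tend to \<open>0\<close> everywhere.
\<close>

lemma positive_decomposition:
  fixes d :: "nat \<Rightarrow> 'a::chilbert_space"
  assumes "positive_op UNIV P" "dense_seq d"
  obtains v :: "nat \<Rightarrow> 'a"
  where "\<And>x. ((\<lambda>i. (cmod (cinner (v i) x))\<^sup>2) has_sum Re (cinner x (P x))) UNIV"
proof -
  define R where "R = schur_rem P d"
  define v where "v i = schur_vec (R i) (d i)" for i
  note R = schur_rem_positive[OF assms(1), of d, folded R_def]
  obtain C0 where C0: "\<And>x. norm (P x) \<le> C0 * norm x"
    using positive_bounded[OF assms(1)] unfolding bounded_op_UNIV by blast
  \<comment> \<open>Adding 1 makes the bound positive, as the quotient \<epsilon> / \<open>C\<close>
    below requires.\<close>
  define C where "C = \<bar>C0\<bar> + 1"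
  have C: "C > 0" "norm (P x) \<le> C * norm x" for x
    using order_trans[OF C0, of x "C * norm x"] by (auto simp: C_def mult_right_mono)
  have form: "Re (cinner x (R k x)) = Re (cinner x (P x)) - (\<Sum>i<k. (cmod (cinner (v i) x))\<^sup>2)" for x k
    unfolding R_def v_def by (rule schur_rem_form)
  have le: "Re (cinner x (R k x)) \<le> C * (norm x)\<^sup>2" for x k
  proof -
    have "Re (cinner x (R k x)) \<le> Re (cinner x (P x))"
      unfolding form by (simp add: sum_nonneg)
    also have "\<dots> \<le> norm x * norm (P x)"
      using Cauchy_Schwarz complex_Re_le_cmod order_trans by blast
    also have "\<dots> \<le> norm x * (C * norm x)" by (intro mult_left_mono C) simp
    finally show ?thesis by (simp add: power2_eq_square mult_ac)
  qed
  have lim: "(\<lambda>k. Re (cinner x (R k x))) \<longlonglongrightarrow> 0" for x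
  proof (rule LIMSEQ_I)
    fix \<epsilon> :: real assume "\<epsilon> > 0"
    then obtain j where j: "norm (x - d j) < sqrt (\<epsilon> / C)"
      using assms(2) C(1) unfolding dense_seq_def by (metis divide_pos_pos real_sqrt_gt_0_iff)
    have "norm (Re (cinner x (R k x)) - 0) < \<epsilon>" if "k \<ge> Suc j" for k
    proof -
      \<comment> \<open>\<open>R k\<close> annihilates \<open>d j\<close> and is Hermitian, so its
        form at \<open>x\<close> equals its form at the short vector \<open>x - d j\<close>, where
        the bound \<open>le\<close> applies uniformly in \<open>k\<close>.\<close>
      have z: "R k (d j) = 0"
        using schur_rem_zero[OF assms(1), of j k d] that unfolding R_def by simp
      have Rx: "R k (x - d j) = R k x"
        using positive_add[OF R, of k "x - d j" "d j"] z by simp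
      have "cinner (d j) (R k x) = 0"
        using positive_hermitian[OF R, of "d j" k x] z by simp
      then have "cinner (x - d j) (R k (x - d j)) = cinner x (R k x)"
        by (simp add: Rx cinner_diff)
      then have "Re (cinner x (R k x)) \<le> C * (norm (x - d j))\<^sup>2" using le[of "x - d j" k] by simp
      also have "\<dots> < C * (\<epsilon> / C)"
        using j C(1) \<open>\<epsilon> > 0\<close> real_sqrt_less_iff[of "(norm (x - d j))\<^sup>2" "\<epsilon> / C"]
        by (intro mult_strict_left_mono) auto
      finally show ?thesis using C(1) positive_form(1)[OF R, of x k] by simp
    qed
    then show "\<exists>no. \<forall>k\<ge>no. norm (Re (cinner x (R k x)) - 0) < \<epsilon>" by blast
  qed
  have "(\<lambda>k. \<Sum>i<k. (cmod (cinner (v i) x))\<^sup>2) \<longlonglongrightarrow> Re (cinner x (P x))" for x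
    using tendsto_diff[OF tendsto_const[of "Re (cinner x (P x))"] lim[of x]] unfolding form by simp
  then have "((\<lambda>i. (cmod (cinner (v i) x))\<^sup>2) has_sum Re (cinner x (P x))) UNIV" for x
    by (intro sums_nonneg_imp_has_sum) (auto simp: sums_def)
  then show ?thesis by (rule that)
qed

text \<open>By Parseval the family |<v i, e>|^2 sums over either basis to the squared norm of
  \<open>v i\<close>, so exchanging nonnegative sums turns both diagonal sums into the sum of these
  squared norms.\<close>

lemma trace_basis_independent:
  fixes P :: "'a::chilbert_space \<Rightarrow> 'a"
  assumes "separable_hilbert_space (UNIV :: 'a set)" "positive_op UNIV P"
    and B: "is_onb UNIV B" "is_onb UNIV B'"
    and t: "((\<lambda>e. Re (cinner e (P e))) has_sum t) B"
  shows "((\<lambda>e. Re (cinner e (P e))) has_sum t) B'"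
proof -
  obtain d :: "nat \<Rightarrow> 'a" where "dense_seq d"
    using assms(1) separable_hilbert_space_UNIV_iff by blast
  with assms(2) obtain v :: "nat \<Rightarrow> 'a"
    where v: "\<And>x. ((\<lambda>i. (cmod (cinner (v i) x))\<^sup>2) has_sum Re (cinner x (P x))) UNIV"
    by (rule positive_decomposition) blast
  have par: "((\<lambda>e. (cmod (cinner (v i) e))\<^sup>2) has_sum (norm (v i))\<^sup>2) A" if "is_onb UNIV A" for i A
    using Parseval[OF that, of "v i"] by (metis (no_types, lifting) cinner_commute complex_mod_cnj has_sum_cong)
  have "((\<lambda>i. (norm (v i))\<^sup>2) has_sum t) UNIV"
    by (rule has_sum_exchange_nonneg[OF _ v t par[OF B(1)]]) simp
  from has_sum_exchange_nonneg[OF _ par[OF B(2)] this v] show ?thesis by simp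
qed

section \<open>Trace-class operators\<close>

text \<open>Demanding one value in all bases makes linearity and unitary invariance immediate; a
  value tied to the chosen \<open>some_onb\<close> would give no access to moved bases.\<close>

definition has_trace :: "('a::chilbert_space \<Rightarrow> 'a) \<Rightarrow> complex \<Rightarrow> bool" where
  "has_trace A t \<longleftrightarrow> (\<forall>B. is_onb UNIV B \<longrightarrow> ((\<lambda>e. cinner e (A e)) has_sum t) B)"

lemma op_trace_eq:
  "op_trace UNIV A = t"
  if "separable_hilbert_space (UNIV :: 'a set)" "has_trace A t" for A :: "'a::chilbert_space \<Rightarrow> 'a"
  using that some_onb unfolding has_trace_def op_trace_def by (blast intro: infsumI)

lemma has_trace_lincomb:
  assumes "has_trace A s" "has_trace B t"
  shows "has_trace (\<lambda>x. a *\<^sub>C A x + b *\<^sub>C B x) (a * s + b * t)"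
  using assms unfolding has_trace_def
  by (auto simp: cinner_add_right cinner_scaleC_right intro!: has_sum_add has_sum_cmult_right)

text \<open>Basis independence extends the summability required in the chosen basis to every basis;
  the diagonal entries are real, so real sums suffice.\<close>

lemma positive_finite_trace_UNIV_iff:
  fixes P :: "'a::chilbert_space \<Rightarrow> 'a"
  assumes "separable_hilbert_space (UNIV :: 'a set)"
  shows "positive_finite_trace UNIV P \<longleftrightarrow> positive_op UNIV P \<and> (\<exists>t. has_trace P t)"
proof
  assume P: "positive_finite_trace UNIV P"
  then have pos: "positive_op UNIV P"
    and "(\<lambda>e. cinner e (P e)) summable_on some_onb UNIV"
    unfolding positive_finite_trace_def by auto
  then obtain t where "((\<lambda>e. cinner e (P e)) has_sum t) (some_onb UNIV)"
    unfolding summable_on_def by blast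
  then have "((\<lambda>e. Re (cinner e (P e))) has_sum Re t) (some_onb UNIV)" by (rule has_sum_Re)
  then have "((\<lambda>e. Re (cinner e (P e))) has_sum Re t) B" if "is_onb UNIV B" for B
    using trace_basis_independent[OF assms pos some_onb[OF assms] that] by blast
  moreover have "cinner e (P e) = of_real (Re (cinner e (P e)))" for e
    using positive_form(2)[OF pos, of e] by (simp add: complex_eq_iff)
  ultimately have "has_trace P (of_real (Re t))"
    unfolding has_trace_def by (metis (no_types, lifting) has_sum_cong has_sum_of_real)
  with pos show "positive_op UNIV P \<and> (\<exists>t. has_trace P t)" by blast
next
  assume "positive_op UNIV P \<and> (\<exists>t. has_trace P t)"
  then show "positive_finite_trace UNIV P"
    using some_onb[OF assms] unfolding positive_finite_trace_def has_trace_def summable_on_def by blast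
qed

section \<open>The trace-class operators as a complex vector space\<close>

lemma sum_less_4: "(\<Sum>k<(4::nat). f k) = f 0 + f 1 + f 2 + f 3" for f :: "nat \<Rightarrow> 'a::comm_monoid_add"
  by (simp add: eval_nat_numeral)

lemma all_less_4: "(\<forall>k<(4::nat). Q k) \<longleftrightarrow> Q 0 \<and> Q 1 \<and> Q 2 \<and> Q 3"
  by (auto simp: eval_nat_numeral less_Suc_eq)

lemma nonneg_Reals_mult_add:
  "of_real r * a + of_real s * b \<in> \<real>\<^sub>\<ge>\<^sub>0" if "0 \<le> r" "0 \<le> s" "a \<in> \<real>\<^sub>\<ge>\<^sub>0" "b \<in> \<real>\<^sub>\<ge>\<^sub>0" for a b :: complex
  using that by (simp add: complex_nonneg_Reals_iff)

lemma positive_op_lincomb: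
  assumes "positive_op UNIV P" "positive_op UNIV Q" "0 \<le> r" "0 \<le> s"
  shows "positive_op UNIV (\<lambda>x. complex_of_real r *\<^sub>C P x + complex_of_real s *\<^sub>C Q x)"
  using assms bounded_op_lincomb[of P Q] nonneg_Reals_mult_add
  unfolding positive_op_def by (simp add: cinner_add_right cinner_scaleC_right)

context
  assumes sep: "separable_hilbert_space (UNIV :: 'a::chilbert_space set)"
begin

lemma positive_finite_trace_lincomb:
  fixes P Q :: "'a \<Rightarrow> 'a"
  assumes "positive_finite_trace UNIV P" "positive_finite_trace UNIV Q" "0 \<le> r" "0 \<le> s"
  shows "positive_finite_trace UNIV (\<lambda>x. complex_of_real r *\<^sub>C P x + complex_of_real s *\<^sub>C Q x)"
  using assms positive_op_lincomb has_trace_lincomb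
  unfolding positive_finite_trace_UNIV_iff[OF sep] by blast

lemma trace_classE:
  fixes A :: "'a \<Rightarrow> 'a"
  assumes "trace_class UNIV A"
  obtains P where "\<And>k. k < 4 \<Longrightarrow> positive_finite_trace UNIV (P k)"
    "\<And>x. A x = (\<Sum>k<4. \<i> ^ k *\<^sub>C P k x)"
  using assms unfolding trace_class_def by blast

lemma trace_class_positive: "trace_class UNIV P" if "positive_finite_trace UNIV P" for P :: "'a \<Rightarrow> 'a"
proof -
  \<comment> \<open>The zero operator fills the other three places of the decomposition.\<close>
  have "positive_finite_trace UNIV (\<lambda>x :: 'a. 0)"
    using positive_finite_trace_lincomb[OF that that, of 0 0] by simp
  then have "\<forall>k<4. positive_finite_trace UNIV ((\<lambda>k x. if k = 0 then P x else 0) (k :: nat))"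
    using that by (simp add: all_less_4)
  moreover have "\<forall>x\<in>UNIV. P x = (\<Sum>k<4. \<i> ^ k *\<^sub>C (if k = 0 then P x else 0))"
    by (simp add: sum_less_4)
  ultimately show ?thesis
    unfolding trace_class_def using that
    by (intro conjI exI[of _ "\<lambda>(k :: nat) x. if k = 0 then P x else 0"])
      (auto simp: positive_finite_trace_def positive_op_def)
qed

lemma trace_class_lincomb_nonneg:
  fixes A B :: "'a \<Rightarrow> 'a"
  assumes "trace_class UNIV A" "trace_class UNIV B" "0 \<le> r" "0 \<le> s"
  shows "trace_class UNIV (\<lambda>x. complex_of_real r *\<^sub>C A x + complex_of_real s *\<^sub>C B x)"
proof -
  obtain P where P: "\<And>k. k < 4 \<Longrightarrow> positive_finite_trace UNIV (P k)"
    "\<And>x. A x = (\<Sum>k<4. \<i> ^ k *\<^sub>C P k x)"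
    using assms(1) by (rule trace_classE) blast
  obtain Q where Q: "\<And>k. k < 4 \<Longrightarrow> positive_finite_trace UNIV (Q k)"
    "\<And>x. B x = (\<Sum>k<4. \<i> ^ k *\<^sub>C Q k x)"
    using assms(2) by (rule trace_classE) blast
  show ?thesis
    unfolding trace_class_def
  proof (intro conjI exI allI impI ballI)
    show "bounded_op UNIV (\<lambda>x. complex_of_real r *\<^sub>C A x + complex_of_real s *\<^sub>C B x)"
      using assms unfolding trace_class_def by (intro bounded_op_lincomb) auto
    show "positive_finite_trace UNIV ((\<lambda>k x. complex_of_real r *\<^sub>C P k x + complex_of_real s *\<^sub>C Q k x) k)"
      if "k < 4" for k
      using positive_finite_trace_lincomb[OF P(1)[OF that] Q(1)[OF that] assms(3,4)] .
  qed (simp add: P(2) Q(2) sum_less_4 cvec.scale_right_distrib cvec.scale_right_diff_distrib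
      scaleC_scaleC mult_ac)
qed

text \<open>The weights of the decomposition are the four powers of \<i>, so multiplication by \<i>
  only permutes the positive parts cyclically.\<close>

lemma trace_class_imaginary:
  fixes A :: "'a \<Rightarrow> 'a"
  assumes "trace_class UNIV A" shows "trace_class UNIV (\<lambda>x. \<i> *\<^sub>C A x)"
proof -
  obtain P where P: "\<And>k. k < 4 \<Longrightarrow> positive_finite_trace UNIV (P k)"
    "\<And>x. A x = (\<Sum>k<4. \<i> ^ k *\<^sub>C P k x)"
    using assms by (rule trace_classE) blast
  show ?thesis
    unfolding trace_class_def
  proof (intro conjI exI allI impI ballI)
    have "bounded_op UNIV A" using assms unfolding trace_class_def by blast
    from bounded_op_lincomb[OF this this, of \<i> 0] show "bounded_op UNIV (\<lambda>x. \<i> *\<^sub>C A x)" by simp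
    \<comment> \<open>Adding 3 is subtracting 1 modulo 4: each part moves on to the next power of
      \<i>.\<close>
    show "positive_finite_trace UNIV ((\<lambda>k. P ((k + 3) mod 4)) k)" for k
      by (rule P(1)) simp
    show "\<i> *\<^sub>C A x = (\<Sum>k<4. \<i> ^ k *\<^sub>C P ((k + 3) mod 4) x)" for x
      by (simp add: P(2) sum_less_4 cvec.scale_right_distrib cvec.scale_right_diff_distrib scaleC_scaleC
          power3_eq_cube)
  qed
qed

lemma trace_class_lincomb:
  fixes A B :: "'a \<Rightarrow> 'a"
  assumes "trace_class UNIV A" "trace_class UNIV B"
  shows "trace_class UNIV (\<lambda>x. a *\<^sub>C A x + b *\<^sub>C B x)"
proof -
  have scale: "trace_class UNIV (\<lambda>x. c *\<^sub>C A x)" if A: "trace_class UNIV A" for c and A :: "'a \<Rightarrow> 'a"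
  proof -
    \<comment> \<open>\<open>A1\<close>, \<open>A2\<close>, \<open>A3\<close> are \<i> A, -A and
      -\<i> A. The positive and negative parts of \<open>Re c\<close> and \<open>Im c\<close> then
      express multiplication by \<open>c\<close> with nonnegative coefficients.\<close>
    define A1 where "A1 = (\<lambda>x. \<i> *\<^sub>C A x)"
    define A2 where "A2 = (\<lambda>x. \<i> *\<^sub>C A1 x)"
    define A3 where "A3 = (\<lambda>x. \<i> *\<^sub>C A2 x)"
    have t: "trace_class UNIV A1" "trace_class UNIV A2" "trace_class UNIV A3"
      unfolding A3_def A2_def A1_def by (intro trace_class_imaginary A)+
    note l = trace_class_lincomb_nonneg
    have "trace_class UNIV (\<lambda>x.
        complex_of_real 1 *\<^sub>C (complex_of_real (max (Re c) 0) *\<^sub>C A x + complex_of_real (max (Im c) 0) *\<^sub>C A1 x)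
        + complex_of_real 1 *\<^sub>C (complex_of_real (max (- Re c) 0) *\<^sub>C A2 x + complex_of_real (max (- Im c) 0) *\<^sub>C A3 x))"
      by (intro l[OF l[OF A t(1)] l[OF t(2,3)]]) auto
    also have "(\<lambda>x.
        complex_of_real 1 *\<^sub>C (complex_of_real (max (Re c) 0) *\<^sub>C A x + complex_of_real (max (Im c) 0) *\<^sub>C A1 x)
        + complex_of_real 1 *\<^sub>C (complex_of_real (max (- Re c) 0) *\<^sub>C A2 x + complex_of_real (max (- Im c) 0) *\<^sub>C A3 x))
      = (\<lambda>x. c *\<^sub>C A x)"
    proof -
      have "of_real (max (Re c) 0) + of_real (max (Im c) 0) * \<i>
          + (of_real (max (- Re c) 0) * (\<i> * \<i>) + of_real (max (- Im c) 0) * (\<i> * (\<i> * \<i>))) = c"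
        by (simp add: complex_eq_iff max_def)
      then show ?thesis
        unfolding A3_def A2_def A1_def scaleC_scaleC scaleC_add_left[symmetric] of_real_1
        by (simp add: mult.assoc)
    qed
    finally show ?thesis .
  qed
  show ?thesis
    using trace_class_lincomb_nonneg[OF scale[OF assms(1), of a] scale[OF assms(2), of b], of 1 1] by simp
qed

text \<open>The four-term decomposition is read as nested binary combinations. Linear claims about
  the channel thus reduce to positive operators, where sums may be exchanged freely.\<close>

lemma trace_class_induct [consumes 1, case_names positive lincomb]:
  fixes A :: "'a \<Rightarrow> 'a"
  assumes "trace_class UNIV A"
    and pos: "\<And>P. positive_finite_trace UNIV P \<Longrightarrow> Q P"
    and lincomb: "\<And>A B a b. trace_class UNIV A \<Longrightarrow> trace_class UNIV B \<Longrightarrow> Q A \<Longrightarrow> Q B \<Longrightarrow>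
      Q (\<lambda>x. a *\<^sub>C A x + b *\<^sub>C B x)"
  shows "Q A"
proof -
  obtain P where P: "\<And>k. k < 4 \<Longrightarrow> positive_finite_trace UNIV (P k)"
    "\<And>x. A x = (\<Sum>k<4. \<i> ^ k *\<^sub>C P k x)"
    using assms(1) by (rule trace_classE) blast
  have tc: "trace_class UNIV (P k)" "Q (P k)" if "k < 4" for k
    using P(1)[OF that] trace_class_positive pos by blast+
  have "Q (\<lambda>x. 1 *\<^sub>C (1 *\<^sub>C P 0 x + \<i> *\<^sub>C P 1 x) + 1 *\<^sub>C (\<i>\<^sup>2 *\<^sub>C P 2 x + \<i>^3 *\<^sub>C P 3 x))"
    by (intro lincomb trace_class_lincomb tc) auto
  also have "(\<lambda>x. 1 *\<^sub>C (1 *\<^sub>C P 0 x + \<i> *\<^sub>C P 1 x) + 1 *\<^sub>C (\<i>\<^sup>2 *\<^sub>C P 2 x + \<i>^3 *\<^sub>C P 3 x)) = A"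
    by (rule ext) (simp add: P(2) sum_less_4 add.assoc)
  finally show ?thesis .
qed

end

section \<open>Random unitary channels\<close>

lemma has_sum_finite_sum:
  fixes f :: "'i \<Rightarrow> 'b \<Rightarrow> 'c::topological_comm_monoid_add"
  assumes "\<And>i. i \<in> I \<Longrightarrow> (f i has_sum s i) A"
  shows "((\<lambda>x. \<Sum>i\<in>I. f i x) has_sum (\<Sum>i\<in>I. s i)) A"
  using assms by (induction I rule: infinite_finite_induct) (auto intro!: has_sum_add)

lemma has_sum_nonneg_Reals:
  fixes s :: complex
  assumes "(f has_sum s) A" "\<And>x. x \<in> A \<Longrightarrow> f x \<in> \<real>\<^sub>\<ge>\<^sub>0"
  shows "s \<in> \<real>\<^sub>\<ge>\<^sub>0"
proof -
  have "0 \<le> Re s"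
    by (rule has_sum_nonneg[OF has_sum_Re[OF assms(1)]])
      (use assms(2) in \<open>simp add: complex_nonneg_Reals_iff\<close>)
  moreover have "((\<lambda>x. Im (f x)) has_sum 0) A"
    using assms(2) by (intro has_sum_0) (simp add: complex_nonneg_Reals_iff)
  then have "Im s = 0" using has_sum_Im[OF assms(1)] has_sum_unique by blast
  ultimately show ?thesis by (simp add: complex_nonneg_Reals_iff)
qed

lemma unitary_op_id: "unitary_op UNIV (\<lambda>x. x :: 'a::chilbert_space)"
  unfolding unitary_op_def using bounded_opI[of "\<lambda>x :: 'a. x"] by simp

text \<open>The sum over the image basis, reindexed along \<open>U\<close>. It takes the place of
  the cyclicity of the trace.\<close>

lemma onb_has_trace_unitary:
  assumes "has_trace A t" "unitary_op UNIV U" "is_onb UNIV B"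
  shows "((\<lambda>e. cinner (U e) (A (U e))) has_sum t) B"
proof -
  have "((\<lambda>e. cinner e (A e)) has_sum t) (U ` B)"
    using assms onb_unitary_image unfolding has_trace_def by blast
  moreover have "inj_on U B"
    using bij_is_inj[OF unitary_bij[OF assms(2)]] by (rule inj_on_subset) simp
  ultimately show ?thesis by (simp add: has_sum_reindex o_def)
qed

text \<open>The channel with its index set normalised to \<open>nat\<close>, matching the levels of
  the memory; weights may vanish.\<close>

locale random_unitary_seq =
  fixes q :: "nat \<Rightarrow> real" and V :: "nat \<Rightarrow> 's \<Rightarrow> 's::chilbert_space"
  assumes sep: "separable_hilbert_space (UNIV :: 's set)"
    and q_nonneg: "0 \<le> q n" and q_sum: "(q has_sum 1) UNIV"
    and unitary_V: "unitary_op UNIV (V n)"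
begin

definition channel :: "('s \<Rightarrow> 's) \<Rightarrow> 's \<Rightarrow> 's" where
  "channel A x = (\<Sum>\<^sub>\<infinity>n. q n *\<^sub>R V n (A (inv (V n) x)))"

lemma norm_term_has_sum: "((\<lambda>n. q n * C) has_sum C) UNIV"
  using has_sum_cmult_left[OF q_sum, of C] by simp

lemma norm_inv_V: "norm (inv (V n) x) = norm x"
  by (rule unitary_norm[OF unitary_inv[OF unitary_V]])

lemma norm_term_le:
  assumes "\<And>x. norm (A x) \<le> C * norm x"
  shows "norm (q n *\<^sub>R V n (A (inv (V n) x))) \<le> q n * (C * norm x)"
  using assms[of "inv (V n) x"] q_nonneg[of n]
  by (simp add: unitary_norm[OF unitary_V] norm_inv_V mult_left_mono)

lemma channel_abs_summable:
  assumes "\<And>x. norm (A x) \<le> C * norm x"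
  shows "(\<lambda>n. norm (q n *\<^sub>R V n (A (inv (V n) x)))) summable_on UNIV"
  by (rule summable_on_comparison_test[OF has_sum_imp_summable[OF norm_term_has_sum[of "C * norm x"]]])
    (rule norm_term_le[OF assms], rule norm_ge_zero)

lemma channel_has_sum:
  assumes "bounded_op UNIV A"
  shows "((\<lambda>n. q n *\<^sub>R V n (A (inv (V n) x))) has_sum channel A x) UNIV"
proof -
  obtain C where "\<And>x. norm (A x) \<le> C * norm x" using assms unfolding bounded_op_UNIV by blast
  then have "(\<lambda>n. q n *\<^sub>R V n (A (inv (V n) x))) summable_on UNIV"
    by (intro abs_summable_summable[OF channel_abs_summable])
  then show ?thesis unfolding channel_def by (rule has_sum_infsum)
qed

lemma term_bounded_op: "bounded_op UNIV (\<lambda>x. V n (A (inv (V n) x)))" if "bounded_op UNIV A"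
  by (rule conjugate_bounded[OF unitary_V that])

lemma V_add: "V n (x + y) = V n x + V n y"
  using unitary_V[of n] unfolding unitary_op_def bounded_op_UNIV by blast

lemma V_scaleC: "V n (c *\<^sub>C x) = c *\<^sub>C V n x"
  using unitary_V[of n] unfolding unitary_op_def bounded_op_UNIV by blast

lemma channel_bounded: "bounded_op UNIV (channel A)" if A: "bounded_op UNIV A"
  unfolding bounded_op_UNIV
proof (intro conjI allI)
  fix x y c
  note T = term_bounded_op[OF A, unfolded bounded_op_UNIV]
  have "((\<lambda>n. q n *\<^sub>R V n (A (inv (V n) (x + y)))) has_sum channel A x + channel A y) UNIV"
    using has_sum_add[OF channel_has_sum[OF A, of x] channel_has_sum[OF A, of y]] T
    by (simp add: scaleR_add_right)
  with channel_has_sum[OF A] show "channel A (x + y) = channel A x + channel A y"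
    by (rule has_sum_unique)
  have "((\<lambda>n. q n *\<^sub>R V n (A (inv (V n) (c *\<^sub>C x)))) has_sum c *\<^sub>C channel A x) UNIV"
    using has_sum_bounded_linear[OF bounded_linear_scaleC[of c] channel_has_sum[OF A, of x]] T
    by (simp add: scaleR_scaleC_commute)
  with channel_has_sum[OF A] show "channel A (c *\<^sub>C x) = c *\<^sub>C channel A x"
    by (rule has_sum_unique)
next
  obtain C where C: "\<And>x. norm (A x) \<le> C * norm x" using A unfolding bounded_op_UNIV by blast
  have "norm (channel A x) \<le> C * norm x" for x
  proof -
    have s: "((\<lambda>n. norm (q n *\<^sub>R V n (A (inv (V n) x)))) has_sum
        (\<Sum>\<^sub>\<infinity>n. norm (q n *\<^sub>R V n (A (inv (V n) x))))) UNIV"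
      by (intro has_sum_infsum channel_abs_summable[OF C])
    have "norm (channel A x) \<le> (\<Sum>\<^sub>\<infinity>n. norm (q n *\<^sub>R V n (A (inv (V n) x))))"
      by (rule norm_has_sum_bound[OF s channel_has_sum[OF A]])
    also have "\<dots> \<le> C * norm x"
      by (rule has_sum_mono[OF s norm_term_has_sum]) (rule norm_term_le[OF C])
    finally show ?thesis .
  qed
  then show "\<exists>C. \<forall>x. norm (channel A x) \<le> C * norm x" by blast
qed

lemma channel_lincomb:
  assumes A: "bounded_op UNIV A" and B: "bounded_op UNIV B"
  shows "channel (\<lambda>x. a *\<^sub>C A x + b *\<^sub>C B x) = (\<lambda>x. a *\<^sub>C channel A x + b *\<^sub>C channel B x)"
proof
  fix x
  have "((\<lambda>n. q n *\<^sub>R V n (a *\<^sub>C A (inv (V n) x) + b *\<^sub>C B (inv (V n) x)))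
      has_sum a *\<^sub>C channel A x + b *\<^sub>C channel B x) UNIV"
    using has_sum_add[OF has_sum_bounded_linear[OF bounded_linear_scaleC[of a] channel_has_sum[OF A, of x]]
        has_sum_bounded_linear[OF bounded_linear_scaleC[of b] channel_has_sum[OF B, of x]]]
    by (simp add: V_add V_scaleC scaleR_add_right scaleR_scaleC_commute)
  with channel_has_sum[OF bounded_op_lincomb[OF A B]]
  show "channel (\<lambda>x. a *\<^sub>C A x + b *\<^sub>C B x) x = a *\<^sub>C channel A x + b *\<^sub>C channel B x"
    by (rule has_sum_unique)
qed

text \<open>The weak form of the series, with \<open>V n\<close> moved to the left argument as its
  inverse. Positivity, traces and the partial trace over the memory are all read off from
  it.\<close>

lemma channel_cinner:
  assumes "bounded_op UNIV A"
  shows "((\<lambda>n. of_real (q n) * cinner (inv (V n) x) (A (inv (V n) y)))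
    has_sum cinner x (channel A y)) UNIV"
  using has_sum_bounded_linear[OF bounded_linear_cinner_right[of x] channel_has_sum[OF assms, of y]]
  by (simp add: cinner_scaleR cinner_unitary_left[OF unitary_V])

lemma channel_positive: "positive_op UNIV (channel P)" if "positive_op UNIV P"
proof -
  have "cinner x (channel P x) \<in> \<real>\<^sub>\<ge>\<^sub>0" for x
    using channel_cinner[OF positive_bounded[OF that]]
    by (rule has_sum_nonneg_Reals)
      (use that q_nonneg in \<open>auto simp: positive_op_def complex_nonneg_Reals_iff\<close>)
  with channel_bounded[OF positive_bounded[OF that]] show ?thesis unfolding positive_op_def by blast
qed

text \<open>Along the basis, the term of index \<open>n\<close> sums to \<open>q n\<close> times the
  trace, because \<open>inv (V n)\<close> merely moves the basis; the weights then add up to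
  1.\<close>

lemma channel_trace_positive:
  assumes P: "positive_op UNIV P" and "has_trace P t"
  shows "has_trace (channel P) t"
  unfolding has_trace_def
proof (intro allI impI)
  fix B :: "'s set" assume B: "is_onb UNIV B"
  define f where "f n e = of_real (q n) * cinner (inv (V n) e) (P (inv (V n) e))" for n e
  have f: "(f n has_sum of_real (q n) * t) B" for n
    unfolding f_def
    by (intro has_sum_cmult_right onb_has_trace_unitary[OF assms(2) unitary_inv[OF unitary_V] B])
  \<comment> \<open>All terms are nonnegative reals, so Tonelli yields the absolute summability on
    the product.\<close>
  have re: "0 \<le> Re (f n e)" "norm (f n e) = Re (f n e)" for n e
    using P q_nonneg by (auto simp: f_def positive_form cmod_def)
  have "((\<lambda>e. Re (f n e)) has_sum q n * Re t) B" for n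
    using has_sum_Re[OF f[of n]] by simp
  from nonneg_summable_on_Times[OF re(1) this has_sum_imp_summable[OF norm_term_has_sum]]
  have "(\<lambda>(n, e). norm (f n e)) summable_on UNIV \<times> B"
    unfolding re(2) .
  moreover have "((\<lambda>n. of_real (q n) * t) has_sum t) UNIV"
    using has_sum_cmult_left[OF has_sum_of_real[OF q_sum], of t] by simp
  ultimately show "((\<lambda>e. cinner e (channel P e)) has_sum t) B"
    by (rule has_sum_exchange[OF _ f])
      (use channel_cinner[OF positive_bounded[OF P]] in \<open>simp add: f_def\<close>)
qed

text \<open>Trace preservation is expressed by a common \<open>t\<close>, which lets both claims
  pass through linear combinations in one induction.\<close>

lemma channel_trace_class:
  assumes "trace_class UNIV A"
  shows "trace_class UNIV (channel A) \<and> (\<exists>t. has_trace A t \<and> has_trace (channel A) t)"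
proof (rule trace_class_induct[OF sep assms])
  fix P :: "'s \<Rightarrow> 's" assume "positive_finite_trace UNIV P"
  then obtain t where "positive_op UNIV P" and t: "has_trace P t"
    unfolding positive_finite_trace_UNIV_iff[OF sep] by blast
  then have "positive_op UNIV (channel P)" "has_trace (channel P) t"
    by (simp_all add: channel_positive channel_trace_positive)
  with t show "trace_class UNIV (channel P) \<and> (\<exists>t. has_trace P t \<and> has_trace (channel P) t)"
    using trace_class_positive[OF sep, of "channel P"] positive_finite_trace_UNIV_iff[OF sep, of "channel P"]
    by blast
next
  fix A B :: "'s \<Rightarrow> 's" and a b
  assume tc: "trace_class UNIV A" "trace_class UNIV B"
    and A: "trace_class UNIV (channel A) \<and> (\<exists>t. has_trace A t \<and> has_trace (channel A) t)"
    and B: "trace_class UNIV (channel B) \<and> (\<exists>t. has_trace B t \<and> has_trace (channel B) t)"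
  have *: "channel (\<lambda>x. a *\<^sub>C A x + b *\<^sub>C B x) = (\<lambda>x. a *\<^sub>C channel A x + b *\<^sub>C channel B x)"
    using tc by (intro channel_lincomb) (auto simp: trace_class_def)
  obtain s t where st: "has_trace A s" "has_trace (channel A) s" "has_trace B t" "has_trace (channel B) t"
    using A B by blast
  have "trace_class UNIV (\<lambda>x. a *\<^sub>C channel A x + b *\<^sub>C channel B x)"
    using A B trace_class_lincomb[OF sep] by blast
  with has_trace_lincomb[OF st(1,3)] has_trace_lincomb[OF st(2,4)]
  show "trace_class UNIV (channel (\<lambda>x. a *\<^sub>C A x + b *\<^sub>C B x)) \<and>
      (\<exists>t. has_trace (\<lambda>x. a *\<^sub>C A x + b *\<^sub>C B x) t \<and>
        has_trace (channel (\<lambda>x. a *\<^sub>C A x + b *\<^sub>C B x)) t)"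
    unfolding * by blast
qed

text \<open>The form of the transformed block at the vectors \<open>x i\<close> is a weighted sum
  over \<open>m\<close> of the original form at the vectors \<open>inv (V m) (x i)\<close>.\<close>

lemma completely_positive_channel:
  assumes "\<And>A. trace_class UNIV A \<Longrightarrow> \<E> A = channel A"
  shows "completely_positive \<E>"
  unfolding completely_positive_def positive_block_def
proof (intro allI impI)
  fix n :: nat and T :: "nat \<Rightarrow> nat \<Rightarrow> 's \<Rightarrow> 's" and x :: "nat \<Rightarrow> 's"
  assume tc: "\<forall>i<n. \<forall>j<n. trace_class UNIV (T i j)"
    and pos: "\<forall>x. (\<Sum>i<n. \<Sum>j<n. cinner (x i) (T i j (x j))) \<in> \<real>\<^sub>\<ge>\<^sub>0"
  have T: "bounded_op UNIV (T i j)" if "i < n" "j < n" for i j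
    using tc that unfolding trace_class_def by blast
  have "((\<lambda>m. \<Sum>i<n. \<Sum>j<n. of_real (q m) * cinner (inv (V m) (x i)) (T i j (inv (V m) (x j))))
      has_sum (\<Sum>i<n. \<Sum>j<n. cinner (x i) (channel (T i j) (x j)))) UNIV"
    by (intro has_sum_finite_sum channel_cinner T) auto
  moreover have "(\<Sum>i<n. \<Sum>j<n. of_real (q m) * cinner (inv (V m) (x i)) (T i j (inv (V m) (x j))))
      \<in> \<real>\<^sub>\<ge>\<^sub>0" for m
    using pos[rule_format, of "\<lambda>i. inv (V m) (x i)"] q_nonneg
    unfolding sum_distrib_left[symmetric] by (simp add: complex_nonneg_Reals_iff)
  ultimately have "(\<Sum>i<n. \<Sum>j<n. cinner (x i) (channel (T i j) (x j))) \<in> \<real>\<^sub>\<ge>\<^sub>0"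
    by (rule has_sum_nonneg_Reals)
  then show "(\<Sum>i<n. \<Sum>j<n. cinner (x i) (\<E> (T i j) (x j))) \<in> \<real>\<^sub>\<ge>\<^sub>0"
    using tc assms by simp
qed

lemma quantum_channel_channel:
  assumes E: "\<And>A. trace_class UNIV A \<Longrightarrow> \<E> A = channel A"
  shows "quantum_channel \<E>"
  unfolding quantum_channel_def
proof (intro conjI allI impI)
  show "trace_class UNIV (\<E> A)" if "trace_class UNIV A" for A
    using channel_trace_class[OF that] E[OF that] by simp
  show "\<E> (\<lambda>x. a *\<^sub>C A x + b *\<^sub>C B x) = (\<lambda>x. a *\<^sub>C \<E> A x + b *\<^sub>C \<E> B x)"
    if A: "trace_class UNIV A" and B: "trace_class UNIV B" for A B a b
    unfolding E[OF A] E[OF B] E[OF trace_class_lincomb[OF sep A B]]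
    using A B by (intro channel_lincomb) (auto simp: trace_class_def)
  show "completely_positive \<E>" using E by (rule completely_positive_channel)
  show "op_trace UNIV (\<E> A) = op_trace UNIV A" if "trace_class UNIV A" for A
    using channel_trace_class[OF that] op_trace_eq[OF sep] unfolding E[OF that] by metis
qed

end

text \<open>The memory has one level per natural number, so the countable index set is embedded into
  \<open>nat\<close>; finite and infinite families are handled alike.\<close>

lemma random_unitary_reindex:
  fixes \<E> :: "('s::chilbert_space \<Rightarrow> 's) \<Rightarrow> 's \<Rightarrow> 's"
  assumes sep: "separable_hilbert_space (UNIV :: 's set)" and ru: "random_unitary J p U \<E>"
  obtains q V where "random_unitary_seq q V"
    "\<And>A. trace_class UNIV A \<Longrightarrow> \<E> A = random_unitary_seq.channel q V A"
proof -
  have "countable J" and p: "\<And>j. j \<in> J \<Longrightarrow> 0 \<le> p j" "(p has_sum 1) J"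
    and U: "\<And>j. j \<in> J \<Longrightarrow> unitary_op UNIV (U j)"
    and E: "\<And>A x. trace_class UNIV A \<Longrightarrow>
      ((\<lambda>j. p j *\<^sub>R conjugate_by UNIV (U j) A x) has_sum \<E> A x) J"
    using ru unfolding random_unitary_def by auto
  define f where "f = to_nat_on J"
  define g where "g = inv_into J f"
  have inj: "inj_on f J" unfolding f_def using \<open>countable J\<close> by (rule inj_on_to_nat_on)
  have gf: "g (f j) = j" if "j \<in> J" for j unfolding g_def using inj that by (rule inv_into_f_f)
  have gJ: "g n \<in> J" if "n \<in> f ` J" for n unfolding g_def using that by (rule inv_into_into)
  define q where "q n = (if n \<in> f ` J then p (g n) else 0)" for n
  \<comment> \<open>Levels outside the image get weight 0 and the identity, which keeps the
    controlled operator unitary on the whole space.\<close>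
  define V where "V n = (if n \<in> f ` J then U (g n) else (\<lambda>x. x))" for n
  \<comment> \<open>Kept general in \<open>h\<close>, since it serves both the weights and the
    operator series.\<close>
  have transfer: "(h has_sum s) UNIV"
    if "(h' has_sum s) J" "\<And>j. j \<in> J \<Longrightarrow> h (f j) = h' j" "\<And>n. n \<notin> f ` J \<Longrightarrow> h n = 0"
    for h :: "nat \<Rightarrow> 'b::real_normed_vector" and h' s
  proof -
    have "((h \<circ> f) has_sum s) J"
      using that(1) has_sum_cong[of J "h \<circ> f" h' s] that(2) by simp
    then have "(h has_sum s) (f ` J)" by (simp add: has_sum_reindex[OF inj])
    then show ?thesis using has_sum_cong_neutral[of "f ` J" UNIV h h s] that(3) by simp
  qed
  have ru: "random_unitary_seq q V"
  proof
    show "separable_hilbert_space (UNIV :: 's set)" by (rule sep)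
    show "0 \<le> q n" for n using p gJ by (simp add: q_def)
    show "(q has_sum 1) UNIV" by (rule transfer[OF p(2)]) (auto simp: q_def gf)
    show "unitary_op UNIV (V n)" for n using U gJ by (simp add: V_def unitary_op_id)
  qed
  then interpret random_unitary_seq q V .
  have "\<E> A = channel A" if A: "trace_class UNIV A" for A
  proof
    fix x
    have "((\<lambda>n. q n *\<^sub>R V n (A (inv (V n) x))) has_sum \<E> A x) UNIV"
      by (rule transfer[OF E[OF A]]) (auto simp: q_def V_def gf conjugate_by_unitary U)
    moreover have "bounded_op UNIV A" using A unfolding trace_class_def by blast
    ultimately show "\<E> A x = channel A x" using channel_has_sum has_sum_unique by blast
  qed
  with ru show ?thesis by (rule that)
qed

section \<open>Square-summable sequences\<close>

lemma ell2_eqI: "(\<And>n. ell2_nth x n = ell2_nth y n) \<Longrightarrow> x = y"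
  by (metis ell2_nth_inject ext)

lemmas ell2_nth_simps [simp] = zero_ell2.rep_eq plus_ell2.rep_eq minus_ell2.rep_eq
  uminus_ell2.rep_eq scaleR_ell2.rep_eq scaleC_ell2.rep_eq

lemma ell2_nth_sum: "ell2_nth (sum f A) n = (\<Sum>i\<in>A. ell2_nth (f i) n)"
  by (induction A rule: infinite_finite_induct) simp_all

lemma ell2_norm_sums: "(\<lambda>n. (norm (ell2_nth x n))\<^sup>2) sums (norm x)\<^sup>2"
proof -
  have s: "summable (\<lambda>n. (norm (ell2_nth x n))\<^sup>2)"
    using ell2_nth[of x] by (simp add: square_summable_def)
  then have "(norm x)\<^sup>2 = (\<Sum>n. (norm (ell2_nth x n))\<^sup>2)"
    by (simp add: norm_ell2.rep_eq suminf_nonneg)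
  with s show ?thesis by (simp add: summable_sums)
qed

lemma cinner_ell2_abs_summable:
  "summable (\<lambda>n. norm (cinner (ell2_nth x n) (ell2_nth y n)))"
proof (rule summable_comparison_test')
  show "summable (\<lambda>n. ((norm (ell2_nth x n))\<^sup>2 + (norm (ell2_nth y n))\<^sup>2) / 2)"
    by (intro summable_divide summable_add sums_summable[OF ell2_norm_sums])
  show "norm (norm (cinner (ell2_nth x n) (ell2_nth y n)))
      \<le> ((norm (ell2_nth x n))\<^sup>2 + (norm (ell2_nth y n))\<^sup>2) / 2" for n
    unfolding real_norm_def abs_norm_cancel by (rule norm_cinner_le)
qed

lemma cinner_ell2_has_sum:
  "((\<lambda>n. cinner (ell2_nth x n) (ell2_nth y n)) has_sum cinner x y) UNIV"
  by (rule norm_summable_imp_has_sum[OF cinner_ell2_abs_summable])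
    (simp add: cinner_ell2.rep_eq summable_sums summable_norm_cancel[OF cinner_ell2_abs_summable])

lemma square_summable_bounded:
  assumes "square_summable f" "\<And>n. norm (g n) \<le> C * norm (f n)"
  shows "square_summable g"
  unfolding square_summable_def
proof (rule summable_comparison_test')
  show "summable (\<lambda>n. C\<^sup>2 * (norm (f n))\<^sup>2)"
    using assms(1) unfolding square_summable_def by (rule summable_mult)
  show "norm ((norm (g n))\<^sup>2) \<le> C\<^sup>2 * (norm (f n))\<^sup>2" for n
    using power_mono[OF assms(2)[of n], of 2] by (simp add: power_mult_distrib)
qed

section \<open>Finitely supported sequences and separability\<close>

definition ell2_single :: "nat \<Rightarrow> 'a::complex_inner \<Rightarrow> 'a ell2" where
  "ell2_single n x = Abs_ell2 (\<lambda>m. if m = n then x else 0)"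

lemma ell2_nth_single [simp]: "ell2_nth (ell2_single n x) m = (if m = n then x else 0)"
proof -
  have "(\<lambda>m. (norm (if m = n then x else 0))\<^sup>2) = (\<lambda>m. if m = n then (norm x)\<^sup>2 else 0)" by auto
  then have "square_summable (\<lambda>m. if m = n then x else 0)"
    unfolding square_summable_def by simp
  then show ?thesis by (simp add: ell2_single_def Abs_ell2_inverse)
qed

lemma cinner_ell2_single: "cinner x (ell2_single n y) = cinner (ell2_nth x n) y"
proof -
  have "((\<lambda>m. cinner (ell2_nth x m) (ell2_nth (ell2_single n y) m))
      has_sum cinner (ell2_nth x n) y) UNIV"
    by (rule has_sum_finite_neutralI[where B = "{n}"]) auto
  with cinner_ell2_has_sum[of x "ell2_single n y"] show ?thesis by (rule has_sum_unique)
qed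

lemma norm_ell2_single: "norm (ell2_single n x) = norm x"
  by (rule norm_eq_if_cinner_eq) (simp add: cinner_ell2_single)

text \<open>The squared error is the tail of the norm series. The result gives separability and also
  the density of elementary tensors.\<close>

lemma ell2_truncation:
  "(\<lambda>N. \<Sum>m<N. ell2_single m (ell2_nth x m)) \<longlonglongrightarrow> x" for x :: "'a::complex_inner ell2"
proof -
  let ?t = "\<lambda>N. \<Sum>m<N. ell2_single m (ell2_nth x m)"
  have "(norm (x - ?t N))\<^sup>2 = (norm x)\<^sup>2 - (\<Sum>m<N. (norm (ell2_nth x m))\<^sup>2)" for N
  proof -
    have nth: "ell2_nth (x - ?t N) m = (if m < N then 0 else ell2_nth x m)" for m
      by (simp add: ell2_nth_sum)
    have "(\<lambda>m. (norm (ell2_nth x m))\<^sup>2 - (if m \<in> {..<N} then (norm (ell2_nth x m))\<^sup>2 else 0))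
        sums ((norm x)\<^sup>2 - (\<Sum>m<N. (norm (ell2_nth x m))\<^sup>2))"
      by (intro sums_diff ell2_norm_sums sums_If_finite_set) simp
    also have "(\<lambda>m. (norm (ell2_nth x m))\<^sup>2 - (if m \<in> {..<N} then (norm (ell2_nth x m))\<^sup>2 else 0))
        = (\<lambda>m. (norm (ell2_nth (x - ?t N) m))\<^sup>2)"
      unfolding nth by auto
    finally show ?thesis using ell2_norm_sums[of "x - ?t N"] sums_unique2 by blast
  qed
  moreover have "(\<lambda>N. (norm x)\<^sup>2 - (\<Sum>m<N. (norm (ell2_nth x m))\<^sup>2)) \<longlonglongrightarrow> 0"
    using tendsto_diff[OF tendsto_const[of "(norm x)\<^sup>2"] ell2_norm_sums[of x, unfolded sums_def]] by simp
  ultimately have "(\<lambda>N. (norm (x - ?t N))\<^sup>2) \<longlonglongrightarrow> 0" by simp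
  then have "(\<lambda>N. sqrt ((norm (x - ?t N))\<^sup>2)) \<longlonglongrightarrow> sqrt 0" by (rule tendsto_real_sqrt)
  then have "(\<lambda>N. norm (?t N - x)) \<longlonglongrightarrow> 0" by (simp add: norm_minus_commute)
  then show ?thesis using LIM_zero_cancel tendsto_norm_zero_iff by blast
qed

lemma separable_ell2:
  assumes "separable_hilbert_space (UNIV :: 'a::chilbert_space set)"
  shows "separable_hilbert_space (UNIV :: 'a ell2 set)"
proof -
  obtain d :: "nat \<Rightarrow> 'a" where d: "dense_seq d"
    using assms separable_hilbert_space_UNIV_iff by blast
  \<comment> \<open>\<open>k\<close> codes a finite list of indices into \<open>d\<close>, hence a
    finitely supported sequence with entries from \<open>d\<close>.\<close>
  define D where "D k = (let l = from_nat k :: nat list in \<Sum>m<length l. ell2_single m (d (l ! m)))" for k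
  have "\<exists>k. norm (x - D k) < \<epsilon>" if "\<epsilon> > 0" for x :: "'a ell2" and \<epsilon>
  proof -
    obtain N where N: "norm ((\<Sum>m<N. ell2_single m (ell2_nth x m)) - x) < \<epsilon> / 2"
      using LIMSEQ_D[OF ell2_truncation[of x], of "\<epsilon> / 2"] \<open>\<epsilon> > 0\<close> by auto
    \<comment> \<open>The error \<epsilon> / 2 is shared among \<open>N\<close> entries; the added 1
      covers \<open>N = 0\<close>.\<close>
    define \<delta> where "\<delta> = \<epsilon> / (2 * (real N + 1))"
    have "\<delta> > 0" using \<open>\<epsilon> > 0\<close> by (simp add: \<delta>_def)
    then have "\<exists>k. norm (ell2_nth x m - d k) < \<delta>" for m
      using d unfolding dense_seq_def by blast
    then obtain k where k: "\<And>m. norm (ell2_nth x m - d (k m)) < \<delta>" by metis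
    define c where "c = to_nat (map k [0..<N])"
    have D: "D c = (\<Sum>m<N. ell2_single m (d (k m)))"
      by (simp add: D_def c_def Let_def)
    have "(\<Sum>m<N. ell2_single m (ell2_nth x m)) - D c = (\<Sum>m<N. ell2_single m (ell2_nth x m - d (k m)))"
      unfolding D sum_subtractf[symmetric] by (intro sum.cong ell2_eqI) auto
    also have "norm \<dots> \<le> (\<Sum>m<N. norm (ell2_nth x m - d (k m)))"
      by (rule order_trans[OF norm_sum]) (simp add: norm_ell2_single)
    also have "\<dots> \<le> (\<Sum>m<N. \<delta>)" using k less_imp_le by (intro sum_mono) blast
    also have "\<dots> \<le> \<epsilon> / 2" using \<open>\<epsilon> > 0\<close> by (simp add: \<delta>_def field_simps)
    finally have "norm (x - D c) < \<epsilon>"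
      using N norm_triangle_ineq[of "x - (\<Sum>m<N. ell2_single m (ell2_nth x m))"
          "(\<Sum>m<N. ell2_single m (ell2_nth x m)) - D c"]
      by (simp add: norm_minus_commute)
    then show ?thesis by blast
  qed
  then show ?thesis unfolding separable_hilbert_space_UNIV_iff dense_seq_def by blast
qed

lemma separable_complex: "separable_hilbert_space (UNIV :: complex set)"
proof -
  obtain C :: "complex set" where C: "countable C"
    "\<And>X. open X \<Longrightarrow> X \<noteq> {} \<Longrightarrow> \<exists>d\<in>C. d \<in> X"
    using countable_dense_exists by blast
  have "\<exists>n. norm (x - from_nat_into C n) < \<epsilon>" if \<epsilon>: "\<epsilon> > 0" for x \<epsilon>
  proof -
    obtain y where "y \<in> C" "y \<in> ball x \<epsilon>" using C(2)[of "ball x \<epsilon>"] \<epsilon> by auto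
    moreover obtain n where "from_nat_into C n = y"
      using from_nat_into_surj[OF C(1) \<open>y \<in> C\<close>] by auto
    ultimately show ?thesis by (auto simp: dist_norm)
  qed
  then show ?thesis unfolding separable_hilbert_space_UNIV_iff dense_seq_def by blast
qed

text \<open>Block-diagonal operators, the common shape of the memory state, the device and their
  products with inputs. The coordinates are as intended once the blocks are uniformly
  bounded.\<close>

definition ell2_diag :: "(nat \<Rightarrow> 'a \<Rightarrow> 'a) \<Rightarrow> 'a::complex_inner ell2 \<Rightarrow> 'a ell2" where
  "ell2_diag W x = Abs_ell2 (\<lambda>n. W n (ell2_nth x n))"

lemma ell2_nth_diag:
  assumes "\<And>n x. norm (W n x) \<le> C * norm x"
  shows "ell2_nth (ell2_diag W x) n = W n (ell2_nth x n)"
proof -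
  have "square_summable (\<lambda>n. W n (ell2_nth x n))"
    by (rule square_summable_bounded[OF _ assms]) (use ell2_nth[of x] in simp)
  then show ?thesis by (simp add: ell2_diag_def Abs_ell2_inverse)
qed

lemma bounded_op_ell2_diag:
  fixes W :: "nat \<Rightarrow> 'a \<Rightarrow> 'a::chilbert_space"
  assumes C: "\<And>n x. norm (W n x) \<le> C * norm x" and W: "\<And>n. bounded_op UNIV (W n)"
  shows "bounded_op UNIV (ell2_diag W)"
  unfolding bounded_op_UNIV
proof (intro conjI allI exI)
  note nth = ell2_nth_diag[OF C]
  show "ell2_diag W (x + y) = ell2_diag W x + ell2_diag W y" for x y
    using W by (intro ell2_eqI) (simp add: nth bounded_op_UNIV)
  show "ell2_diag W (c *\<^sub>C x) = c *\<^sub>C ell2_diag W x" for c x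
    using W by (intro ell2_eqI) (simp add: nth bounded_op_UNIV)
  \<comment> \<open>On a trivial space \<open>C\<close> may be negative, hence the absolute
    value.\<close>
  show "norm (ell2_diag W x) \<le> \<bar>C\<bar> * norm x" for x
  proof -
    have "(norm (ell2_nth (ell2_diag W x) n))\<^sup>2 \<le> \<bar>C\<bar>\<^sup>2 * (norm (ell2_nth x n))\<^sup>2" for n
      using power_mono[OF C[of n "ell2_nth x n"], of 2] by (simp add: nth power_mult_distrib)
    from sums_le[OF this ell2_norm_sums sums_mult[OF ell2_norm_sums]]
    have "(norm (ell2_diag W x))\<^sup>2 \<le> (\<bar>C\<bar> * norm x)\<^sup>2" by (simp add: power_mult_distrib)
    then show ?thesis by (rule power2_le_imp_le) simp
  qed
qed

lemma ell2_diag_unitary: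
  fixes V :: "nat \<Rightarrow> 'a \<Rightarrow> 'a::chilbert_space"
  assumes "\<And>n. unitary_op UNIV (V n)"
  shows "unitary_op UNIV (ell2_diag V)" "inv (ell2_diag V) = ell2_diag (\<lambda>n. inv (V n))"
proof -
  have C: "norm (V n x) \<le> 1 * norm x" "norm (inv (V n) x) \<le> 1 * norm x" for n x
    by (simp_all add: unitary_norm assms unitary_inv)
  note nth = ell2_nth_diag[OF C(1)] ell2_nth_diag[OF C(2)]
  have bij: "bij (V n)" for n by (rule unitary_bij[OF assms])
  have l: "ell2_diag (\<lambda>n. inv (V n)) (ell2_diag V x) = x"
    and r: "ell2_diag V (ell2_diag (\<lambda>n. inv (V n)) x) = x" for x
    by (intro ell2_eqI; simp add: nth bij inv_f_f bij_is_inj surj_f_inv_f bij_is_surj)+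
  then show "inv (ell2_diag V) = ell2_diag (\<lambda>n. inv (V n))" by (intro inv_equality)
  have "bounded_op UNIV (ell2_diag V)"
    using assms unfolding unitary_op_def by (intro bounded_op_ell2_diag[OF C(1)]) auto
  moreover have "surj (ell2_diag V)" using r by (metis surjI)
  moreover have "cinner (ell2_diag V x) (ell2_diag V y) = cinner x y" for x y
  proof -
    have "cinner (V n z) (V n w) = cinner z w" for n z w
      using assms unfolding unitary_op_def by blast
    then show ?thesis
      using cinner_ell2_has_sum[of "ell2_diag V x" "ell2_diag V y"] cinner_ell2_has_sum[of x y]
      by (simp add: nth has_sum_unique)
  qed
  ultimately show "unitary_op UNIV (ell2_diag V)" unfolding unitary_op_def by blast
qed

text \<open>Parseval for the unit vector at level \<open>n\<close>: the squared moduli of the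
  \<open>n\<close>-th coordinates over a basis add up to 1. It evaluates both the trace of the
  memory state and the partial trace over the memory.\<close>

lemma onb_ell2_weighted_sum:
  fixes z :: "nat \<Rightarrow> complex"
  assumes B: "is_onb UNIV (B :: complex ell2 set)"
    and z: "(\<lambda>n. norm (z n)) summable_on UNIV" "(z has_sum s) UNIV"
    and h: "\<And>e. e \<in> B \<Longrightarrow> ((\<lambda>n. of_real ((cmod (ell2_nth e n))\<^sup>2) * z n) has_sum h e) UNIV"
  shows "(h has_sum s) B"
proof -
  have one: "((\<lambda>e. (cmod (ell2_nth e n))\<^sup>2) has_sum 1) B" for n
    using Parseval[OF B, of "ell2_single n 1"]
    by (simp add: cinner_ell2_single norm_ell2_single cinner_complex_def)
  have n: "norm (of_real ((cmod (ell2_nth e n))\<^sup>2) * z n) = (cmod (ell2_nth e n))\<^sup>2 * norm (z n)" for e n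
    by (simp add: norm_mult norm_power)
  have "(\<lambda>(n, e). norm (of_real ((cmod (ell2_nth e n))\<^sup>2) * z n)) summable_on UNIV \<times> B"
    unfolding n using has_sum_cmult_left[OF one]
    by (intro nonneg_summable_on_Times[where g = "\<lambda>n. 1 * norm (z n)"]) (use z(1) in auto)
  moreover have "((\<lambda>e. of_real ((cmod (ell2_nth e n))\<^sup>2) * z n) has_sum z n) B" for n
    using has_sum_cmult_left[OF has_sum_of_real[OF one[of n]], of "z n"] by simp
  ultimately show ?thesis by (rule has_sum_exchange[OF _ _ z(2) h])
qed

text \<open>Coordinate \<open>n\<close> is the component along memory level \<open>n\<close>, so
  operators controlled by the memory become block diagonal.\<close>

definition ell2_tensor :: "complex ell2 \<Rightarrow> 's::complex_inner \<Rightarrow> 's ell2" where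
  "ell2_tensor a x = Abs_ell2 (\<lambda>n. ell2_nth a n *\<^sub>C x)"

lemma ell2_nth_tensor [simp]: "ell2_nth (ell2_tensor a x) n = ell2_nth a n *\<^sub>C x"
proof -
  have "square_summable (\<lambda>n. ell2_nth a n *\<^sub>C x)"
    by (rule square_summable_bounded[of "ell2_nth a" _ "norm x"])
      (use ell2_nth[of a] in \<open>simp_all add: norm_scaleC mult.commute\<close>)
  then show ?thesis by (simp add: ell2_tensor_def Abs_ell2_inverse)
qed

lemma ell2_tensor_product:
  assumes "separable_hilbert_space (UNIV :: 's::chilbert_space set)"
  shows "hilbert_tensor_product UNIV UNIV UNIV (ell2_tensor :: complex ell2 \<Rightarrow> 's \<Rightarrow> 's ell2)"
proof
  show "separable_hilbert_space (UNIV :: complex ell2 set)"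
    by (rule separable_ell2[OF separable_complex])
  show "separable_hilbert_space (UNIV :: 's set)" by (rule assms)
  show "separable_hilbert_space (UNIV :: 's ell2 set)" by (rule separable_ell2[OF assms])
  fix a b :: "complex ell2" and x y :: 's and c :: complex
  show "ell2_tensor (a + b) x = ell2_tensor a x + ell2_tensor b x"
    "ell2_tensor a (x + y) = ell2_tensor a x + ell2_tensor a y"
    "ell2_tensor (c *\<^sub>C a) x = c *\<^sub>C ell2_tensor a x"
    "ell2_tensor a (c *\<^sub>C x) = c *\<^sub>C ell2_tensor a x"
    by (rule ell2_eqI; simp add: scaleC_add_left scaleC_add_right scaleC_scaleC scaleC_complex_def mult.commute)+
  have "((\<lambda>n. cinner (ell2_nth a n) (ell2_nth b n) * cinner x y) has_sum cinner a b * cinner x y) UNIV"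
    by (intro has_sum_cmult_left cinner_ell2_has_sum)
  then show "cinner (ell2_tensor a x) (ell2_tensor b y) = cinner a b * cinner x y"
    using cinner_ell2_has_sum[of "ell2_tensor a x" "ell2_tensor b y"]
    by (simp add: cinner_scaleC_left cinner_scaleC_right cinner_complex_def mult_ac has_sum_unique)
next
  let ?T = "{ell2_tensor a (x :: 's) | a x. a \<in> UNIV \<and> x \<in> UNIV}"
  have "z \<in> closure (cvec.span ?T)" for z :: "'s ell2"
  proof -
    \<comment> \<open>Finitely supported sequences are thus sums of elementary tensors, and
      truncations converge.\<close>
    have "ell2_single m x = ell2_tensor (ell2_single m 1) x" for m and x :: 's
      by (rule ell2_eqI) simp
    then have "ell2_single m x \<in> ?T" for m and x :: 's by blast
    then have "(\<Sum>m<N. ell2_single m (ell2_nth z m)) \<in> cvec.span ?T" for N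
      by (intro cvec.span_sum cvec.span_base)
    then show ?thesis using ell2_truncation[of z] unfolding closure_sequential
      by (intro exI[of _ "\<lambda>N. \<Sum>m<N. ell2_single m (ell2_nth z m)"]) blast
  qed
  then show "closure (cvec.span ?T) = UNIV" by blast
qed

text \<open>The set of agreement is closed and contains the span. This is the uniqueness behind
  \<open>op_tensor\<close>, which is prescribed on elementary tensors only.\<close>

lemma bounded_op_eq_on_dense_span:
  assumes "bounded_op UNIV A" "bounded_op UNIV B" "\<And>x. x \<in> S \<Longrightarrow> A x = B x"
    and "closure (cvec.span S) = UNIV"
  shows "A = B"
proof
  fix x
  have lin: "bounded_linear A" "bounded_linear B" using assms by (simp_all add: bounded_op_bounded_linear)
  have "A y = B y" if "y \<in> cvec.span S" for y
    using that
  proof (induction rule: cvec.span_induct_alt)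
    case base
    then show ?case using lin by (simp add: linear_0 bounded_linear.linear)
  next
    case (step c x y)
    then show ?case using assms(1-3) by (simp add: bounded_op_UNIV)
  qed
  then have "cvec.span S \<subseteq> {y. A y = B y}" by blast
  moreover have "closed {y. A y = B y}"
    using lin by (intro closed_Collect_eq linear_continuous_on)
  ultimately have "closure (cvec.span S) \<subseteq> {y. A y = B y}" by (rule closure_minimal)
  then show "A x = B x" using assms(4) by blast
qed

section \<open>The controlled unitary device\<close>

context random_unitary_seq
begin

definition memory_op :: "complex ell2 \<Rightarrow> complex ell2" where
  "memory_op = ell2_diag (\<lambda>n z. q n *\<^sub>R z)"

definition device_op :: "'s ell2 \<Rightarrow> 's ell2" where
  "device_op = ell2_diag V"

lemma q_le_1: "q n \<le> 1"
  using has_sum_mono_neutral[OF has_sum_finite[of "{n}" q] q_sum] q_nonneg by simp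

lemma q_scaleR_le: "norm (q n *\<^sub>R x) \<le> 1 * norm x" for x :: "'a::real_normed_vector"
  using q_nonneg[of n] q_le_1[of n] by (simp add: mult_left_le_one_le)

lemma nth_memory_op: "ell2_nth (memory_op x) n = q n *\<^sub>R ell2_nth x n"
  unfolding memory_op_def by (rule ell2_nth_diag[OF q_scaleR_le])

lemma norm_weighted_le:
  assumes "\<And>x. norm (A x) \<le> C * norm x"
  shows "norm (q n *\<^sub>R A x) \<le> C * norm x"
  using order_trans[OF q_scaleR_le[of n "A x"]] assms[of x] by simp

lemma memory_op_bounded: "bounded_op UNIV memory_op"
  unfolding memory_op_def
proof (rule bounded_op_ell2_diag[OF q_scaleR_le])
  show "bounded_op UNIV (\<lambda>z :: complex. q n *\<^sub>R z)" for n
    by (intro bounded_opI bounded_linear_scaleR_right scaleR_scaleC_commute)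
qed

lemma memory_op_positive: "positive_op UNIV memory_op"
proof -
  have "cinner x (memory_op x) \<in> \<real>\<^sub>\<ge>\<^sub>0" for x
    using cinner_ell2_has_sum[of x "memory_op x"]
  proof (rule has_sum_nonneg_Reals)
    show "cinner (ell2_nth x n) (ell2_nth (memory_op x) n) \<in> \<real>\<^sub>\<ge>\<^sub>0" for n
      using q_nonneg[of n]
      by (simp add: nth_memory_op cinner_scaleR cinner_self complex_nonneg_Reals_iff flip: of_real_power)
  qed
  with memory_op_bounded show ?thesis unfolding positive_op_def by blast
qed

lemma memory_op_trace: "has_trace memory_op 1"
  unfolding has_trace_def
proof (intro allI impI)
  fix B :: "complex ell2 set" assume B: "is_onb UNIV B"
  show "((\<lambda>e. cinner e (memory_op e)) has_sum 1) B"
  proof (rule onb_ell2_weighted_sum[OF B, of "\<lambda>n. of_real (q n)"])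
    show "(\<lambda>n. norm (of_real (q n) :: complex)) summable_on UNIV"
      using has_sum_imp_summable[OF q_sum] q_nonneg by simp
    show "((\<lambda>n. of_real (q n)) has_sum (1 :: complex)) UNIV"
      using has_sum_of_real[OF q_sum] by simp
    show "((\<lambda>n. of_real ((cmod (ell2_nth e n))\<^sup>2) * of_real (q n)) has_sum cinner e (memory_op e)) UNIV" for e
      using cinner_ell2_has_sum[of e "memory_op e"]
      by (simp add: nth_memory_op cinner_scaleR cinner_self mult.commute)
  qed
qed

lemma memory_op_density: "density_op UNIV memory_op"
proof -
  have sepM: "separable_hilbert_space (UNIV :: complex ell2 set)"
    by (rule separable_ell2[OF separable_complex])
  have "positive_finite_trace UNIV memory_op"
    using memory_op_positive memory_op_trace unfolding positive_finite_trace_UNIV_iff[OF sepM] by blast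
  then show ?thesis
    unfolding density_op_def
    using memory_op_positive trace_class_positive[OF sepM] op_trace_eq[OF sepM memory_op_trace] by blast
qed

sublocale device: memory_device UNIV UNIV UNIV ell2_tensor device_op memory_op
proof -
  interpret hilbert_tensor_product UNIV UNIV UNIV "ell2_tensor :: complex ell2 \<Rightarrow> 's \<Rightarrow> 's ell2"
    by (rule ell2_tensor_product[OF sep])
  show "memory_device UNIV UNIV UNIV (ell2_tensor :: complex ell2 \<Rightarrow> 's \<Rightarrow> 's ell2) device_op memory_op"
    by unfold_locales
      (simp_all add: device_op_def ell2_diag_unitary unitary_V memory_op_density)
qed

lemma op_tensor_memory_op:
  assumes A: "bounded_op UNIV A"
  shows "device.op_tensor memory_op A = ell2_diag (\<lambda>n x. q n *\<^sub>R A x)"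
  unfolding device.op_tensor_def
proof (rule the_equality)
  obtain C where "\<And>x. norm (A x) \<le> C * norm x" using A unfolding bounded_op_UNIV by blast
  then have C: "norm (q n *\<^sub>R A x) \<le> C * norm x" for n x by (rule norm_weighted_le)
  have "bounded_op UNIV (ell2_diag (\<lambda>n x. q n *\<^sub>R A x))"
  proof (rule bounded_op_ell2_diag[OF C])
    show "bounded_op UNIV (\<lambda>x. q n *\<^sub>R A x)" for n
      using bounded_op_lincomb[OF A A, of "of_real (q n)" 0] by (simp add: scaleC_of_real)
  qed
  moreover have "ell2_diag (\<lambda>n x. q n *\<^sub>R A x) (ell2_tensor a x) = ell2_tensor (memory_op a) (A x)" for a x
    by (rule ell2_eqI, unfold ell2_nth_diag[OF C] ell2_nth_tensor nth_memory_op)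
      (simp add: bounded_op_scaleC[OF A] scaleC_of_real[symmetric] scaleC_scaleC scaleC_complex_def)
  ultimately show d: "bounded_op UNIV (ell2_diag (\<lambda>n x. q n *\<^sub>R A x)) \<and> (\<forall>a\<in>UNIV. \<forall>x\<in>UNIV.
      ell2_diag (\<lambda>n x. q n *\<^sub>R A x) (ell2_tensor a x) = ell2_tensor (memory_op a) (A x))" by blast
  fix D assume D: "bounded_op UNIV D \<and>
    (\<forall>a\<in>UNIV. \<forall>x\<in>UNIV. D (ell2_tensor a x) = ell2_tensor (memory_op a) (A x))"
  show "D = ell2_diag (\<lambda>n x. q n *\<^sub>R A x)"
    by (rule bounded_op_eq_on_dense_span[OF _ _ _ device.tensor_dense]) (use d D in auto)
qed

lemma nth_evolved:
  assumes A: "bounded_op UNIV A"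
  shows "ell2_nth (conjugate_by UNIV device_op (device.op_tensor memory_op A) x) n
    = q n *\<^sub>R V n (A (inv (V n) (ell2_nth x n)))"
proof -
  obtain C where "\<And>x. norm (A x) \<le> C * norm x" using A unfolding bounded_op_UNIV by blast
  then have C: "norm (q n *\<^sub>R A x) \<le> C * norm x" for n x by (rule norm_weighted_le)
  have V1: "norm (V n x) \<le> 1 * norm x" "norm (inv (V n) x) \<le> 1 * norm x" for n x
    by (simp_all add: unitary_norm unitary_V norm_inv_V)
  have "V n (q n *\<^sub>R z) = q n *\<^sub>R V n z" for z
    by (simp add: scaleC_of_real[symmetric] V_scaleC)
  then show ?thesis
    unfolding op_tensor_memory_op[OF A] device_op_def
      conjugate_by_unitary[OF ell2_diag_unitary(1)[OF unitary_V]] ell2_diag_unitary(2)[OF unitary_V]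
    by (simp add: ell2_nth_diag[OF C] ell2_nth_diag[OF V1(1)] ell2_nth_diag[OF V1(2)])
qed

text \<open>The memory and system factors separate in each block. Setting \<open>a = b\<close> and
  summing gives the partial trace over the memory; setting \<open>x = y\<close> gives the one over
  the system.\<close>

lemma evolved_has_sum:
  assumes "bounded_op UNIV A"
  shows "((\<lambda>n. cnj (ell2_nth a n) * (q n *\<^sub>R ell2_nth b n) * cinner (inv (V n) x) (A (inv (V n) y)))
    has_sum cinner (ell2_tensor a x)
      (conjugate_by UNIV device_op (device.op_tensor memory_op A) (ell2_tensor b y))) UNIV"
proof -
  have "inv (V n) (c *\<^sub>C z) = c *\<^sub>C inv (V n) z" for n c z
    using unitary_inv[OF unitary_V[of n]] unfolding unitary_op_def by (simp add: bounded_op_scaleC)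
  then show ?thesis
    using cinner_ell2_has_sum[of "ell2_tensor a x"
        "conjugate_by UNIV device_op (device.op_tensor memory_op A) (ell2_tensor b y)"]
    by (simp add: nth_evolved[OF assms] bounded_op_scaleC[OF assms] V_scaleC cinner_scaleR
        cinner_scaleC_left cinner_scaleC_right cinner_unitary_left[OF unitary_V] scaleR_conv_of_real
        mult_ac)
qed

text \<open>With equal memory vectors the weights are squared moduli of coordinates, so summing over
  a memory basis removes them and leaves the weak series of \<open>channel\<close>.\<close>

lemma partial_trace_M_evolved:
  assumes A: "bounded_op UNIV A"
  shows "device.partial_trace_M (conjugate_by UNIV device_op (device.op_tensor memory_op A)) = channel A"
  unfolding device.partial_trace_M_def
proof (rule the_equality)
  let ?T = "conjugate_by UNIV device_op (device.op_tensor memory_op A)"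
  let ?B = "some_onb (UNIV :: complex ell2 set)"
  have B: "is_onb UNIV ?B" by (rule some_onb[OF separable_ell2[OF separable_complex]])
  have sum: "((\<lambda>e. cinner (ell2_tensor e x) (?T (ell2_tensor e y))) has_sum cinner x (channel A y)) ?B" for x y
  proof (rule onb_ell2_weighted_sum[OF B _ channel_cinner[OF A]])
    obtain C where C: "\<And>x. norm (A x) \<le> C * norm x" using A unfolding bounded_op_UNIV by blast
    show "(\<lambda>n. norm (of_real (q n) * cinner (inv (V n) x) (A (inv (V n) y)))) summable_on UNIV"
    proof (rule summable_on_comparison_test[OF has_sum_imp_summable[OF norm_term_has_sum]])
      fix n
      have "norm (cinner (inv (V n) x) (A (inv (V n) y))) \<le> norm x * (C * norm y)"
        using order_trans[OF Cauchy_Schwarz[of "inv (V n) x" "A (inv (V n) y)"]]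
          mult_left_mono[OF C[of "inv (V n) y"], of "norm x"]
        by (simp add: norm_inv_V)
      then show "norm (of_real (q n) * cinner (inv (V n) x) (A (inv (V n) y))) \<le> q n * (norm x * (C * norm y))"
        using q_nonneg[of n] by (simp add: norm_mult mult_left_mono)
    qed simp
    fix e
    have "complex_of_real ((cmod z)\<^sup>2) = z * cnj z" for z using complex_norm_square[of z] by simp
    then show "((\<lambda>n. of_real ((cmod (ell2_nth e n))\<^sup>2)
        * (of_real (q n) * cinner (inv (V n) x) (A (inv (V n) y))))
        has_sum cinner (ell2_tensor e x) (?T (ell2_tensor e y))) UNIV"
      using evolved_has_sum[OF A, of e e x y] by (simp add: scaleR_conv_of_real mult_ac)
  qed
  then show "bounded_op UNIV (channel A) \<and> (\<forall>x\<in>UNIV. \<forall>y\<in>UNIV.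
      ((\<lambda>e. cinner (ell2_tensor e x) (?T (ell2_tensor e y))) has_sum cinner x (channel A y)) ?B)"
    using channel_bounded[OF A] by blast
  fix R assume R: "bounded_op UNIV R \<and> (\<forall>x\<in>UNIV. \<forall>y\<in>UNIV.
      ((\<lambda>e. cinner (ell2_tensor e x) (?T (ell2_tensor e y))) has_sum cinner x (R y)) ?B)"
  show "R = channel A"
  proof (rule ext, rule cinner_ext)
    show "cinner x (R y) = cinner x (channel A y)" for x y
      using R sum[of x y] has_sum_unique by blast
  qed
qed

text \<open>\<open>channel_trace_class\<close> supplies a trace valid in every basis; its value 1 is
  read off in the chosen one.\<close>

lemma density_op_has_trace:
  fixes \<rho> :: "'s \<Rightarrow> 's"
  assumes "density_op UNIV \<rho>" shows "has_trace \<rho> 1"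
proof -
  obtain t where "has_trace \<rho> t"
    using assms channel_trace_class unfolding density_op_def by blast
  with op_trace_eq[OF sep this] assms show ?thesis unfolding density_op_def by simp
qed

lemma partial_trace_S_evolved:
  assumes \<rho>: "density_op UNIV \<rho>"
  shows "device.partial_trace_S (conjugate_by UNIV device_op (device.op_tensor memory_op \<rho>)) = memory_op"
  unfolding device.partial_trace_S_def
proof (rule the_equality)
  let ?T = "conjugate_by UNIV device_op (device.op_tensor memory_op \<rho>)"
  let ?B = "some_onb (UNIV :: 's set)"
  have pos: "positive_op UNIV \<rho>" using \<rho> unfolding density_op_def by blast
  note bd = positive_bounded[OF pos]
  \<comment> \<open>Basis independence enters here: the conjugated input has trace 1 at every level,
    whatever the moved basis.\<close>
  have tr: "((\<lambda>e. cinner (inv (V n) e) (\<rho> (inv (V n) e))) has_sum 1) ?B" for n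
    by (rule onb_has_trace_unitary[OF density_op_has_trace[OF \<rho>] unitary_inv[OF unitary_V] some_onb[OF sep]])
  have sum: "((\<lambda>e. cinner (ell2_tensor a e) (?T (ell2_tensor b e))) has_sum cinner a (memory_op b)) ?B" for a b
  proof -
    \<comment> \<open>\<open>w\<close> collects the memory factors and \<open>t\<close> the system
      factors. Summing over \<open>e\<close> first turns \<open>t\<close> into 1; absolute
      summability of \<open>w\<close> and positivity of \<open>t\<close> justify the
      exchange.\<close>
    define w where "w n = cinner (ell2_nth a n) (ell2_nth (memory_op b) n)" for n
    define t where "t n e = cinner (inv (V n) e) (\<rho> (inv (V n) e))" for n e
    have t: "0 \<le> Re (t n e)" "norm (t n e) = Re (t n e)" for n e
      by (auto simp: t_def positive_form[OF pos] cmod_def)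
    have "((\<lambda>e. norm (w n) * Re (t n e)) has_sum norm (w n)) ?B" for n
      using has_sum_cmult_right[OF has_sum_Re[OF tr[of n]], of "norm (w n)"] by (simp add: t_def)
    moreover have "(\<lambda>n. norm (w n)) summable_on UNIV"
      unfolding w_def by (intro summable_nonneg_imp_summable_on cinner_ell2_abs_summable) simp
    ultimately have "(\<lambda>(n, e). norm (w n * t n e)) summable_on UNIV \<times> ?B"
      unfolding norm_mult t(2) by (intro nonneg_summable_on_Times) (auto simp: t(1))
    moreover have "((\<lambda>e. w n * t n e) has_sum w n) ?B" for n
      using has_sum_cmult_right[OF tr[of n], of "w n"] by (simp add: t_def)
    moreover have "(w has_sum cinner a (memory_op b)) UNIV"
      unfolding w_def by (rule cinner_ell2_has_sum)
    moreover have "((\<lambda>n. w n * t n e) has_sum cinner (ell2_tensor a e) (?T (ell2_tensor b e))) UNIV" for e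
      using evolved_has_sum[OF bd, of a b e e] by (simp add: w_def t_def cinner_complex_def nth_memory_op)
    ultimately show ?thesis by (rule has_sum_exchange)
  qed
  then show "bounded_op UNIV memory_op \<and> (\<forall>a\<in>UNIV. \<forall>b\<in>UNIV.
      ((\<lambda>e. cinner (ell2_tensor a e) (?T (ell2_tensor b e))) has_sum cinner a (memory_op b)) ?B)"
    using memory_op_bounded by blast
  fix R assume R: "bounded_op UNIV R \<and> (\<forall>a\<in>UNIV. \<forall>b\<in>UNIV.
      ((\<lambda>e. cinner (ell2_tensor a e) (?T (ell2_tensor b e))) has_sum cinner a (R b)) ?B)"
  show "R = memory_op"
  proof (rule ext, rule cinner_ext)
    show "cinner a (R b) = cinner a (memory_op b)" for a b
      using R sum[of a b] has_sum_unique by blast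
  qed
qed

lemma memory_state_const: "device.memory_state \<rho> j = memory_op" if "\<And>j. density_op UNIV (\<rho> j)"
  by (induction j) (simp_all add: partial_trace_S_evolved that)

lemma induced_channel_eq:
  "device.induced_channel \<rho> j A = channel A"
  if "\<And>j. density_op UNIV (\<rho> j)" "bounded_op UNIV A"
  unfolding device.induced_channel_def memory_state_const[OF that(1)]
  by (rule partial_trace_M_evolved[OF that(2)])

end

theorem theorem1:
  fixes \<E> :: "('s::chilbert_space \<Rightarrow> 's) \<Rightarrow> 's \<Rightarrow> 's"
    and J :: "'i set" and p :: "'i \<Rightarrow> real" and U :: "'i \<Rightarrow> 's \<Rightarrow> 's"
  assumes "separable_hilbert_space (UNIV :: 's set)"
    and "random_unitary J p U \<E>"
  shows "repeatable \<E>"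
proof -
  obtain q V where "random_unitary_seq q V"
    and E: "\<And>A. trace_class UNIV A \<Longrightarrow> \<E> A = random_unitary_seq.channel q V A"
    using random_unitary_reindex[OF assms] by blast
  then interpret random_unitary_seq q V by blast
  \<comment> \<open>The whole types serve as memory and composite space, even for finite
    \<open>J\<close>.\<close>
  have "memory_device UNIV UNIV UNIV (ell2_tensor :: complex ell2 \<Rightarrow> 's \<Rightarrow> 's ell2) device_op memory_op"
    by (rule device.memory_device_axioms)
  moreover have "device.induced_channel \<rho> j A = \<E> A"
    if "\<forall>j. density_op UNIV (\<rho> j)" "trace_class UNIV A" for \<rho> j A
    using that by (simp add: induced_channel_eq E trace_class_def)
  ultimately show ?thesis
    unfolding repeatable_def using quantum_channel_channel[OF E] by blast
qed

end
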